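(* Let $n\in\mathbb{N}$. The following properties hold: (i) If $\varphi\in RO$, then $\mathcal{S}(\mathbb{Z}^n)$ is dense in $H^{\varphi}(\mathbb{Z}^n)$. (ii) If $\varphi_0,\varphi_1\in RO$ and $\frac{\varphi_0}{\varphi_1}$ is bounded in a neighborhood of $\infty$, then there is a continuous embedding $H^{\varphi_1}(\mathbb{Z}^n)\hookrightarrow H^{\varphi_0}(\mathbb{Z}^n)$. (iii) If $\varphi\in RO$, then the sesquilinear form $(u,v)=\sum_{k\in\mathbb{Z}^n}u(k)\overline{v(k)}$ extends to a sesquilinear duality (separately continuous sesquilinear form) $$(\cdot,\cdot)\colon H^{\varphi}(\mathbb{Z}^n)\times H^{\frac1\varphi}(\mathbb{Z}^n)\to\mathbb{C},$$ and the spaces $H^{\varphi}(\mathbb{Z}^n)$ and $H^{\frac1\varphi}(\mathbb{Z}^n)$ are mutually dual relative to this form. (iv) If $\varphi\in RO$ satisfies $$\sum_{k\in\mathbb{Z}^n}\frac{1}{[\varphi(\langle k\rangle)]^2}<\infty,$$ then there is a continuous embedding $H^{\varphi}(\mathbb{Z}^n)\hookrightarrow\ell^{\infty}(\mathbb{Z}^n)$.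
   Context: Notation on $\mathbb{Z}^n$: $|k|=\sqrt{k_1^2+\dots+k_n^2}$ and $\langle k\rangle=(1+|k|^2)^{1/2}$. $\ell^2(\mathbb{Z}^n)$ is the Hilbert space of square summable functions $u\colon\mathbb{Z}^n\to\mathbb{C}$ with inner product $(u,v)=\sum_{k\in\mathbb{Z}^n}u(k)\overline{v(k)}$; $\ell^\infty(\mathbb{Z}^n)$ is the space of bounded functions $u\colon\mathbb{Z}^n\to\mathbb{C}$ with norm $\|u\|_\infty=\sup_{k}|u(k)|$. $\mathcal{S}(\mathbb{Z}^n)$ is the Schwartz space of functions $u\colon\mathbb{Z}^n\to\mathbb{C}$ with $\sup_{k}|k^{\alpha}(\Delta_k^{\beta}u)(k)|<\infty$ for all $\alpha,\beta\in\mathbb{N}_0^n$, where $\Delta_{k_j}u(k)=u(k+e_j)-u(k)$ and $\Delta_k^\beta=\Delta_{k_1}^{\beta_1}\cdots\Delta_{k_n}^{\beta_n}$. $\mathcal{S}'(\mathbb{Z}^n)$ is the space of continuous linear functionals on $\mathcal{S}(\mathbb{Z}^n)$, identified with functions $u\colon\mathbb{Z}^n\to\mathbb{C}$ of at most polynomial growth acting by $v\mapsto\sum_k u(k)v(k)$. $RO$-varying functions: $\varphi\in RO$ means that $\varphi\colon[1,\infty)\to(0,\infty)$ is Borel measurable and there exist $a>1$, $c\geq1$ with $c^{-1}\leq\varphi(\lambda t)/\varphi(t)\leq c$ for all $t\geq1$, $\lambda\in[1,a]$. For $\varphi\in RO$, $H^{\varphi}(\mathbb{Z}^n)=\{u\in\mathcal{S}'(\mathbb{Z}^n):\varphi(\langle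 k\rangle)u\in\ell^2(\mathbb{Z}^n)\}$ with inner product $(u,v)_{H^{\varphi}(\mathbb{Z}^n)}=\sum_{k\in\mathbb{Z}^n}[\varphi(\langle k\rangle)]^2u(k)\overline{v(k)}$. Duality: "sesquilinear" means linear in the first and anti-linear in the second variable. The form $(\cdot,\cdot)$ in (iii) is initially considered on $\mathcal{S}(\mathbb{Z}^n)\times\mathcal{S}(\mathbb{Z}^n)$ and extended by continuity. "Mutually dual relative to the form" means: $u\mapsto(u,\cdot)$ is an isomorphism (linear homeomorphism) of $H^{\varphi}(\mathbb{Z}^n)$ onto the space of continuous anti-linear functionals on $H^{1/\varphi}(\mathbb{Z}^n)$, and $v\mapsto(\cdot,v)$ is an isomorphism of the complex-conjugate space of $H^{1/\varphi}(\mathbb{Z}^n)$ onto the space of continuous linear functionals on $H^{\varphi}(\mathbb{Z}^n)$. *)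

theory Defs
  imports "HOL-Analysis.Analysis"
begin

section \<open>Function spaces on the integer lattice\<close>

text \<open>The lattice \<open>\<int>\<^sup>n\<close> is the type \<open>int ^ 'n\<close> with \<open>n = CARD('n) \<ge> 1\<close>.\<close>

definition lattice_norm :: "int ^ 'n::finite \<Rightarrow> real" where
  "lattice_norm k = sqrt (\<Sum>i\<in>UNIV. (real_of_int (k $ i))\<^sup>2)"

definition bracket :: "int ^ 'n::finite \<Rightarrow> real" where
  "bracket k = sqrt (1 + (lattice_norm k)\<^sup>2)"

definition ell2 :: "(int ^ 'n::finite \<Rightarrow> complex) set" where
  "ell2 = {u. (\<lambda>k. (cmod (u k))\<^sup>2) summable_on UNIV}"

definition ell2_form :: "(int ^ 'n::finite \<Rightarrow> complex) \<Rightarrow> (int ^ 'n \<Rightarrow> complex) \<Rightarrow> complex" where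
  "ell2_form u v = (\<Sum>\<^sub>\<infinity>k\<in>UNIV. u k * cnj (v k))"

definition ell_inf :: "(int ^ 'n::finite \<Rightarrow> complex) set" where
  "ell_inf = {u. bounded (range u)}"

definition ell_inf_norm :: "(int ^ 'n::finite \<Rightarrow> complex) \<Rightarrow> real" where
  "ell_inf_norm u = (SUP k. cmod (u k))"

definition fwd_diff :: "'n::finite \<Rightarrow> (int ^ 'n \<Rightarrow> complex) \<Rightarrow> (int ^ 'n \<Rightarrow> complex)" where
  "fwd_diff j u = (\<lambda>k. u (k + axis j 1) - u k)"

text \<open>The composition of the operators \<open>\<Delta>\<^sub>j\<close> to the power \<open>\<beta>\<^sub>j\<close> over all \<open>j\<close>. The index type carries
  no order, but the operators commute (lemma \<open>comp_fun_commute_fwd_diff\<close> below), so the fold is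
  independent of the order of the factors.\<close>

definition fwd_diff_multi :: "nat ^ 'n::finite \<Rightarrow> (int ^ 'n \<Rightarrow> complex) \<Rightarrow> (int ^ 'n \<Rightarrow> complex)" where
  "fwd_diff_multi \<beta> u = Finite_Set.fold (\<lambda>j. fwd_diff j ^^ (\<beta> $ j)) u UNIV"

lemma fwd_diff_commute: "fwd_diff i \<circ> fwd_diff j = fwd_diff j \<circ> fwd_diff i"
  by (rule ext)+ (simp add: fwd_diff_def algebra_simps)

lemma comp_fun_commute_fwd_diff: "comp_fun_commute (\<lambda>j. fwd_diff j ^^ (\<beta> $ j))"
proof
  have 0: "fwd_diff i (fwd_diff j u) = fwd_diff j (fwd_diff i u)" for i j :: 'a and u
    using fun_cong[OF fwd_diff_commute] by simp
  have 1: "fwd_diff i ((fwd_diff j ^^ n) u) = (fwd_diff j ^^ n) (fwd_diff i u)" for i j :: 'a and n u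
    by (induction n) (simp, metis 0 comp_apply funpow.simps(2))
  have "(fwd_diff i ^^ m) ((fwd_diff j ^^ n) u) = (fwd_diff j ^^ n) ((fwd_diff i ^^ m) u)"
    for i j :: 'a and m n u
    by (induction m) (simp_all add: 1)
  then show "(fwd_diff i ^^ (\<beta> $ i)) \<circ> (fwd_diff j ^^ (\<beta> $ j))
           = (fwd_diff j ^^ (\<beta> $ j)) \<circ> (fwd_diff i ^^ (\<beta> $ i))" for i j :: 'a
    by (simp add: fun_eq_iff)
qed

definition multi_power :: "int ^ 'n::finite \<Rightarrow> nat ^ 'n \<Rightarrow> int" where
  "multi_power k \<alpha> = (\<Prod>i\<in>UNIV. (k $ i) ^ (\<alpha> $ i))"

definition schwartz :: "(int ^ 'n::finite \<Rightarrow> complex) set" where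
  "schwartz = {u. \<forall>\<alpha> \<beta>. bdd_above (range (\<lambda>k. cmod (of_int (multi_power k \<alpha>) * fwd_diff_multi \<beta> u k)))}"

text \<open>The dual of the Schwartz space, under its identification with the functions of at most
  polynomial growth.\<close>

definition tempered :: "(int ^ 'n::finite \<Rightarrow> complex) set" where
  "tempered = {u. \<exists>C. \<exists>N::nat. \<forall>k. cmod (u k) \<le> C * bracket k ^ N}"

text \<open>Only the values of \<open>\<phi>\<close> on \<open>[1,\<infinity>)\<close> matter.\<close>

definition RO :: "(real \<Rightarrow> real) set" where
  "RO = {\<phi>. \<phi> \<in> borel_measurable (restrict_space borel {1..}) \<and> (\<forall>t\<ge>1. 0 < \<phi> t) \<and>
     (\<exists>a>1. \<exists>c\<ge>1. \<forall>t\<ge>1. \<forall>r\<in>{1..a}. inverse c \<le> \<phi> (r * t) / \<phi> t \<and> \<phi> (r * t) / \<phi> t \<le> c)}"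

definition H_space :: "(real \<Rightarrow> real) \<Rightarrow> (int ^ 'n::finite \<Rightarrow> complex) set" where
  "H_space \<phi> = {u \<in> tempered. (\<lambda>k. of_real (\<phi> (bracket k)) * u k) \<in> ell2}"

definition H_inner :: "(real \<Rightarrow> real) \<Rightarrow> (int ^ 'n::finite \<Rightarrow> complex) \<Rightarrow> (int ^ 'n \<Rightarrow> complex) \<Rightarrow> complex" where
  "H_inner \<phi> u v = (\<Sum>\<^sub>\<infinity>k\<in>UNIV. of_real ((\<phi> (bracket k))\<^sup>2) * u k * cnj (v k))"

definition H_norm :: "(real \<Rightarrow> real) \<Rightarrow> (int ^ 'n::finite \<Rightarrow> complex) \<Rightarrow> real" where
  "H_norm \<phi> u = sqrt (Re (H_inner \<phi> u u))"


section \<open>Normed spaces of complex-valued functions given by a carrier and a norm\<close>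

text \<open>The operations are pointwise. The distance is set to 0 off the carrier \<open>V\<close>, because the locale
  \<open>Metric_space\<close> asks for a nonnegative distance everywhere, while a supremum norm is unspecified
  on unbounded functions. The topology does not depend on these values.\<close>

definition norm_dist :: "('a \<Rightarrow> complex) set \<Rightarrow> (('a \<Rightarrow> complex) \<Rightarrow> real) \<Rightarrow>
    ('a \<Rightarrow> complex) \<Rightarrow> ('a \<Rightarrow> complex) \<Rightarrow> real" where
  "norm_dist V N u v = (if u \<in> V \<and> v \<in> V then N (\<lambda>x. u x - v x) else 0)"

definition norm_topology :: "('a \<Rightarrow> complex) set \<Rightarrow> (('a \<Rightarrow> complex) \<Rightarrow> real) \<Rightarrow> ('a \<Rightarrow> complex) topology" where
  "norm_topology V N = Metric_space.mtopology V (norm_dist V N)"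

definition continuously_embedded ::
    "('a \<Rightarrow> complex) set \<Rightarrow> (('a \<Rightarrow> complex) \<Rightarrow> real) \<Rightarrow> ('a \<Rightarrow> complex) set \<Rightarrow> (('a \<Rightarrow> complex) \<Rightarrow> real) \<Rightarrow> bool" where
  "continuously_embedded V N W M \<longleftrightarrow>
     V \<subseteq> W \<and> continuous_map (norm_topology V N) (norm_topology W M) (\<lambda>u. u)"

text \<open>Here \<open>\<sigma>\<close> is the identity for linear and complex conjugation for anti-linear functionals.\<close>

definition semilinear_functional ::
    "(complex \<Rightarrow> complex) \<Rightarrow> ('a \<Rightarrow> complex) set \<Rightarrow> (('a \<Rightarrow> complex) \<Rightarrow> complex) \<Rightarrow> bool" where
  "semilinear_functional \<sigma> V f \<longleftrightarrow>
     (\<forall>u\<in>V. \<forall>v\<in>V. f (\<lambda>x. u x + v x) = f u + f v) \<and>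
     (\<forall>c. \<forall>u\<in>V. f (\<lambda>x. c * u x) = \<sigma> c * f u)"

abbreviation "linear_functional \<equiv> semilinear_functional (\<lambda>c. c)"
abbreviation "antilinear_functional \<equiv> semilinear_functional cnj"

definition semilinear_operator ::
    "(complex \<Rightarrow> complex) \<Rightarrow> ('a \<Rightarrow> complex) set \<Rightarrow> (('a \<Rightarrow> complex) \<Rightarrow> ('b \<Rightarrow> complex)) \<Rightarrow> bool" where
  "semilinear_operator \<sigma> V T \<longleftrightarrow>
     (\<forall>u\<in>V. \<forall>v\<in>V. T (\<lambda>x. u x + v x) = (\<lambda>y. T u y + T v y)) \<and>
     (\<forall>c. \<forall>u\<in>V. T (\<lambda>x. c * u x) = (\<lambda>y. \<sigma> c * T u y))"

text \<open>The continuous \<open>\<sigma>\<close>-linear functionals on \<open>V\<close>, extended by 0 outside the carrier so that each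
  functional is represented by exactly one function, with the operator norm.\<close>

definition dual_space :: "(complex \<Rightarrow> complex) \<Rightarrow> ('a \<Rightarrow> complex) set \<Rightarrow> (('a \<Rightarrow> complex) \<Rightarrow> real) \<Rightarrow>
    (('a \<Rightarrow> complex) \<Rightarrow> complex) set" where
  "dual_space \<sigma> V N = {f. semilinear_functional \<sigma> V f \<and>
      continuous_map (norm_topology V N) euclidean f \<and> (\<forall>v. v \<notin> V \<longrightarrow> f v = 0)}"

definition dual_norm :: "('a \<Rightarrow> complex) set \<Rightarrow> (('a \<Rightarrow> complex) \<Rightarrow> real) \<Rightarrow>
    (('a \<Rightarrow> complex) \<Rightarrow> complex) \<Rightarrow> real" where
  "dual_norm V N f = (SUP v\<in>{v \<in> V. N v \<le> 1}. cmod (f v))"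

definition dual_topology :: "(complex \<Rightarrow> complex) \<Rightarrow> ('a \<Rightarrow> complex) set \<Rightarrow> (('a \<Rightarrow> complex) \<Rightarrow> real) \<Rightarrow>
    (('a \<Rightarrow> complex) \<Rightarrow> complex) topology" where
  "dual_topology \<sigma> V N = norm_topology (dual_space \<sigma> V N) (dual_norm V N)"

definition separately_continuous_sesquilinear ::
    "('a \<Rightarrow> complex) set \<Rightarrow> (('a \<Rightarrow> complex) \<Rightarrow> real) \<Rightarrow> ('b \<Rightarrow> complex) set \<Rightarrow> (('b \<Rightarrow> complex) \<Rightarrow> real) \<Rightarrow>
     (('a \<Rightarrow> complex) \<Rightarrow> ('b \<Rightarrow> complex) \<Rightarrow> complex) \<Rightarrow> bool" where
  "separately_continuous_sesquilinear V N W M B \<longleftrightarrow>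
     (\<forall>w\<in>W. linear_functional V (\<lambda>v. B v w) \<and> continuous_map (norm_topology V N) euclidean (\<lambda>v. B v w)) \<and>
     (\<forall>v\<in>V. antilinear_functional W (B v) \<and> continuous_map (norm_topology W M) euclidean (B v))"

text \<open>An isomorphism from the complex-conjugate space of \<open>W\<close> is an anti-linear homeomorphism from
  \<open>W\<close>, since conjugating the scalars changes neither the carrier nor the norm.\<close>

definition mutually_dual ::
    "('a \<Rightarrow> complex) set \<Rightarrow> (('a \<Rightarrow> complex) \<Rightarrow> real) \<Rightarrow> ('b \<Rightarrow> complex) set \<Rightarrow> (('b \<Rightarrow> complex) \<Rightarrow> real) \<Rightarrow>
     (('a \<Rightarrow> complex) \<Rightarrow> ('b \<Rightarrow> complex) \<Rightarrow> complex) \<Rightarrow> bool" where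
  "mutually_dual V N W M B \<longleftrightarrow>
     (let L = (\<lambda>v w. if w \<in> W then B v w else 0);
          R = (\<lambda>w v. if v \<in> V then B v w else 0)
      in semilinear_operator (\<lambda>c. c) V L \<and>
         homeomorphic_map (norm_topology V N) (dual_topology cnj W M) L \<and>
         semilinear_operator cnj W R \<and>
         homeomorphic_map (norm_topology W M) (dual_topology (\<lambda>c. c) V N) R)"

end

theory Submission
  imports Defs
begin

text \<open>
  The functions in \<open>H\<^sup>\<phi>(\<int>\<^sup>n)\<close> live on a discrete set, and \<open>\<phi>\<close> enters only through the numbers
  \<open>w k = \<phi> \<langle>k\<rangle> > 0\<close>. The bound \<open>c\<^sup>-\<^sup>1 \<le> \<phi>(\<lambda>t) / \<phi>(t) \<le> c\<close>, iterated along the powers of \<open>a\<close>, shows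
  that \<open>\<phi>\<close> and \<open>1/\<phi>\<close> grow at most polynomially (\<open>RO_growth\<close>). So every function \<open>u\<close> with
  \<open>w u \<in> \<ell>\<^sup>2\<close> has polynomial growth, temperedness is automatic, and \<open>H\<^sup>\<phi>\<close> is exactly a weighted
  \<open>\<ell>\<^sup>2\<close> space (\<open>H_space_eq\<close>, \<open>H_norm_eq\<close>). Topology and duality are therefore proved for
  weighted \<open>\<ell>\<^sup>2\<close> spaces over an arbitrary index set and an arbitrary positive weight.

  Density: finitely supported functions are Schwartz functions, and truncating \<open>u\<close> to large finite
  sets converges to \<open>u\<close> because the tails of a convergent sum of nonnegative terms are small
  (\<open>wl2_truncate\<close>). Conversely a Schwartz function decays faster than any power of \<open>\<langle>k\<rangle>\<close>
  (\<open>schwartz_decay\<close>), which beats the growth of \<open>\<phi>\<close> and leaves the summable factor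
  \<open>\<Prod>\<^sub>i 1 / (1 + k\<^sub>i\<^sup>2)\<close>.

  Embeddings: each one is an inequality between norms. If \<open>\<phi>\<^sub>0/\<phi>\<^sub>1\<close> is bounded near infinity then
  it is bounded on all of \<open>[1,\<infinity>)\<close>, since the polynomial bounds control it on the remaining
  bounded interval. If \<open>1/w \<in> \<ell>\<^sup>2\<close> then \<open>1/w\<close> is bounded, and \<open>\<bar>u k\<bar> \<le> \<parallel>u\<parallel> / w k\<close>.

  Duality: \<open>(u,v) = \<Sum>\<^sub>k u k \<cdot> cnj (v k)\<close> converges absolutely for \<open>u \<in> \<ell>\<^sup>2(w)\<close>, \<open>v \<in> \<ell>\<^sup>2(1/w)\<close> by the
  Cauchy-Schwarz inequality for \<open>w u\<close> and \<open>v / w\<close>. Testing \<open>u\<close> against \<open>w\<^sup>2 u\<close> shows that the functional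
  \<open>(u,\<cdot>)\<close> has norm exactly \<open>\<parallel>u\<parallel>\<close> (\<open>dual_norm_pairing\<close>); a continuous functional \<open>f\<close> is represented
  by its values on the unit vectors (\<open>pairing_represents\<close>). Hence \<open>u \<mapsto> (u,\<cdot>)\<close> is an isometry onto the
  dual and so a homeomorphism. The other variable follows by conjugation with the weights exchanged.
\<close>

section \<open>Normed spaces of functions as metric spaces\<close>

locale function_norm =
  fixes V :: "('a \<Rightarrow> complex) set" and N :: "('a \<Rightarrow> complex) \<Rightarrow> real"
  assumes zero_mem: "(\<lambda>x. 0) \<in> V"
    and add_mem: "u \<in> V \<Longrightarrow> v \<in> V \<Longrightarrow> (\<lambda>x. u x + v x) \<in> V"
    and scale_mem: "u \<in> V \<Longrightarrow> (\<lambda>x. c * u x) \<in> V"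
    and norm_add: "u \<in> V \<Longrightarrow> v \<in> V \<Longrightarrow> N (\<lambda>x. u x + v x) \<le> N u + N v"
    and norm_scale: "u \<in> V \<Longrightarrow> N (\<lambda>x. c * u x) = cmod c * N u"
    and norm_definite: "u \<in> V \<Longrightarrow> N u \<le> 0 \<Longrightarrow> u = (\<lambda>x. 0)"
begin

lemma norm_zero: "N (\<lambda>x. 0) = 0"
  using norm_scale[OF zero_mem, of 0] by simp

lemma diff_mem: "u \<in> V \<Longrightarrow> v \<in> V \<Longrightarrow> (\<lambda>x. u x - v x) \<in> V"
  using add_mem[OF _ scale_mem[of v "-1"], of u] by simp

lemma norm_minus_commute: "u \<in> V \<Longrightarrow> v \<in> V \<Longrightarrow> N (\<lambda>x. u x - v x) = N (\<lambda>x. v x - u x)"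
  using norm_scale[OF diff_mem[of v u], of "-1"] by simp

lemma norm_nonneg: "u \<in> V \<Longrightarrow> 0 \<le> N u"
  using norm_add[OF _ scale_mem[of u "-1"], of u] norm_scale[of u "-1"] norm_zero by simp

lemma Metric_space_norm_dist: "Metric_space V (norm_dist V N)"
proof
  fix u v w
  show "0 \<le> norm_dist V N u v"
    by (simp add: norm_dist_def diff_mem norm_nonneg)
  show "norm_dist V N u v = norm_dist V N v u"
    using norm_minus_commute[of u v] by (auto simp: norm_dist_def)
  assume [simp]: "u \<in> V" "v \<in> V"
  show "norm_dist V N u v = 0 \<longleftrightarrow> u = v"
  proof
    assume "norm_dist V N u v = 0"
    then have "(\<lambda>x. u x - v x) = (\<lambda>x. 0)"
      using norm_definite[OF diff_mem[of u v]] by (simp add: norm_dist_def)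
    then show "u = v" by (auto simp: fun_eq_iff)
  qed (simp add: norm_dist_def norm_zero)
  assume [simp]: "w \<in> V"
  show "norm_dist V N u w \<le> norm_dist V N u v + norm_dist V N v w"
    using norm_add[OF diff_mem[of u v] diff_mem[of v w]] by (simp add: norm_dist_def)
qed

lemma continuous_into_normed:
  assumes "function_norm W M" and T: "T \<in> V \<rightarrow> W"
    and bound: "\<And>u v. u \<in> V \<Longrightarrow> v \<in> V \<Longrightarrow> M (\<lambda>x. T u x - T v x) \<le> C * N (\<lambda>x. u x - v x)"
  shows "continuous_map (norm_topology V N) (norm_topology W M) T"
proof -
  interpret W: function_norm W M by fact
  interpret Metric_space V "norm_dist V N" by (rule Metric_space_norm_dist)
  have "\<exists>\<delta>>0. \<forall>v. v \<in> V \<and> norm_dist V N u v < \<delta> \<longrightarrow> norm_dist W M (T u) (T v) < \<epsilon>"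
    if "u \<in> V" "0 < \<epsilon>" for u and \<epsilon> :: real
  proof (intro exI conjI allI impI)
    show "0 < \<epsilon> / (\<bar>C\<bar> + 1)" using that by simp
    fix v assume v: "v \<in> V \<and> norm_dist V N u v < \<epsilon> / (\<bar>C\<bar> + 1)"
    have "norm_dist W M (T u) (T v) \<le> C * norm_dist V N u v"
      using v that T bound[of u v] by (simp add: norm_dist_def Pi_iff)
    also have "\<dots> \<le> (\<bar>C\<bar> + 1) * norm_dist V N u v"
      by (rule mult_right_mono) auto
    also have "\<dots> < \<epsilon>" using v by (simp add: field_simps)
    finally show "norm_dist W M (T u) (T v) < \<epsilon>" .
  qed
  then show ?thesis
    unfolding norm_topology_def metric_continuous_map[OF W.Metric_space_norm_dist]
    using T by auto
qed

lemma continuous_functional: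
  assumes f: "semilinear_functional \<sigma> V f"
    and bound: "\<And>u. u \<in> V \<Longrightarrow> cmod (f u) \<le> C * N u"
  shows "continuous_map (norm_topology V N) euclidean f"
proof -
  interpret Metric_space V "norm_dist V N" by (rule Metric_space_norm_dist)
  have diff: "f u - f v = f (\<lambda>x. u x - v x)" if "u \<in> V" "v \<in> V" for u v
    using f[unfolded semilinear_functional_def, THEN conjunct1, rule_format,
        OF diff_mem[OF that] that(2)] by simp
  have "\<exists>\<delta>>0. \<forall>v. v \<in> V \<and> norm_dist V N u v < \<delta> \<longrightarrow> dist (f u) (f v) < \<epsilon>"
    if "u \<in> V" "0 < \<epsilon>" for u and \<epsilon> :: real
  proof (intro exI conjI allI impI)
    show "0 < \<epsilon> / (\<bar>C\<bar> + 1)" using that by simp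
    fix v assume v: "v \<in> V \<and> norm_dist V N u v < \<epsilon> / (\<bar>C\<bar> + 1)"
    have "dist (f u) (f v) \<le> C * norm_dist V N u v"
      using v that bound[OF diff_mem[of u v]] diff[of u v] by (simp add: norm_dist_def dist_norm)
    also have "\<dots> \<le> (\<bar>C\<bar> + 1) * norm_dist V N u v"
      by (rule mult_right_mono) auto
    also have "\<dots> < \<epsilon>" using v by (simp add: field_simps)
    finally show "dist (f u) (f v) < \<epsilon>" .
  qed
  then show ?thesis
    unfolding norm_topology_def mtopology_is_euclidean[symmetric]
      metric_continuous_map[OF Met_TC.Metric_space_axioms]
    by auto
qed

text \<open>Continuity at \<open>0\<close> bounds the functional on a small ball, and homogeneity rescales this
  bound to all of \<open>V\<close>. Both \<open>\<sigma> = id\<close> and \<open>\<sigma> = cnj\<close> preserve the modulus, so linear and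
  anti-linear functionals are treated at once.\<close>

lemma continuous_functional_bounded:
  assumes f: "semilinear_functional \<sigma> V f" and \<sigma>: "\<And>c. cmod (\<sigma> c) = cmod c"
    and cont: "continuous_map (norm_topology V N) euclidean f"
  obtains C where "0 \<le> C" "\<And>u. u \<in> V \<Longrightarrow> cmod (f u) \<le> C * N u"
proof -
  interpret Metric_space V "norm_dist V N" by (rule Metric_space_norm_dist)
  have scale: "f (\<lambda>x. c * u x) = \<sigma> c * f u" if "u \<in> V" for c u
    using f that by (simp add: semilinear_functional_def)
  have \<sigma>0: "\<sigma> 0 = 0" using \<sigma>[of 0] by simp
  then have f0: "f (\<lambda>x. 0) = 0" using scale[OF zero_mem, of 0] by simp
  obtain \<delta> where \<delta>: "\<delta> > 0"
    "\<And>v. v \<in> V \<Longrightarrow> norm_dist V N (\<lambda>x. 0) v < \<delta> \<Longrightarrow> dist (f (\<lambda>x. 0)) (f v) < 1"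
    using cont zero_mem zero_less_one
    unfolding norm_topology_def mtopology_is_euclidean[symmetric]
      metric_continuous_map[OF Met_TC.Metric_space_axioms] by metis
  have small: "cmod (f v) < 1" if "v \<in> V" "N v < \<delta>" for v
    using \<delta>(2)[OF that(1)] that norm_minus_commute[OF zero_mem that(1)] f0
    by (simp add: norm_dist_def zero_mem dist_norm)
  show ?thesis
  proof
    show "0 \<le> 2 / \<delta>" using \<delta> by simp
    fix u assume u: "u \<in> V"
    show "cmod (f u) \<le> 2 / \<delta> * N u"
    proof (cases "N u = 0")
      case True
      then have "u = (\<lambda>x. 0)" using norm_definite u by simp
      then show ?thesis using f0 True by simp
    next
      case False
      then have pos: "N u > 0" using norm_nonneg[OF u] by simp
      \<comment> \<open>The factor that moves \<open>u\<close> onto the sphere of radius \<open>\<delta>/2\<close>, inside the ball of radius \<open>\<delta>\<close>.\<close>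
      let ?c = "complex_of_real (\<delta> / (2 * N u))"
      have c: "cmod ?c = \<delta> / (2 * N u)"
        unfolding norm_of_real using pos \<delta>(1) by simp
      have "N (\<lambda>x. ?c * u x) = \<delta> / 2"
        unfolding norm_scale[OF u] c using pos by simp
      then have "cmod (f (\<lambda>x. ?c * u x)) < 1"
        using \<delta>(1) by (intro small scale_mem u) simp
      then have "\<delta> / (2 * N u) * cmod (f u) < 1"
        unfolding scale[OF u] norm_mult \<sigma> c .
      then show ?thesis using pos \<delta>(1) by (simp add: field_simps)
    qed
  qed
qed

text \<open>The metric axioms for the target are inherited from \<open>V\<close> along the isometry, which
  applies in particular to a dual space with its operator norm.\<close>

lemma homeomorphic_map_isometry:
  assumes onto: "T ` V = W"
    and iso: "\<And>u v. u \<in> V \<Longrightarrow> v \<in> V \<Longrightarrow> M (\<lambda>x. T u x - T v x) = N (\<lambda>x. u x - v x)"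
  shows "homeomorphic_map (norm_topology V N) (norm_topology W M) T"
proof -
  interpret A: Metric_space V "norm_dist V N" by (rule Metric_space_norm_dist)
  have dist: "norm_dist W M (T u) (T v) = norm_dist V N u v" if "u \<in> V" "v \<in> V" for u v
    using iso[OF that] that onto by (auto simp: norm_dist_def)
  interpret B: Metric_space W "norm_dist W M"
  proof
    have ex: "\<exists>u\<in>V. f = T u" if "f \<in> W" for f using that onto by auto
    fix f g h
    show "0 \<le> norm_dist W M f g"
    proof (cases "f \<in> W \<and> g \<in> W")
      case True
      then show ?thesis using ex[of f] ex[of g] dist by auto
    qed (auto simp: norm_dist_def)
    show "norm_dist W M f g = norm_dist W M g f"
    proof (cases "f \<in> W \<and> g \<in> W")
      case True
      then show ?thesis using ex[of f] ex[of g] dist A.commute by auto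
    qed (auto simp: norm_dist_def)
    assume fg: "f \<in> W" "g \<in> W"
    obtain u v where uv: "u \<in> V" "f = T u" "v \<in> V" "g = T v" using ex fg by blast
    show "norm_dist W M f g = 0 \<longleftrightarrow> f = g"
    proof
      assume "norm_dist W M f g = 0" then show "f = g" using uv dist A.zero by auto
    next
      assume "f = g"
      then show "norm_dist W M f g = 0" using uv dist[OF uv(1) uv(1)] by simp
    qed
    assume h: "h \<in> W"
    then obtain w where "w \<in> V" "h = T w" using ex by blast
    then show "norm_dist W M f h \<le> norm_dist W M f g + norm_dist W M g h"
      using uv dist A.triangle by simp
  qed
  interpret Metric_space12 V "norm_dist V N" W "norm_dist W M" ..
  show ?thesis
    unfolding norm_topology_def by (rule isometry_imp_homeomorphic_map[OF onto dist])
qed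

end

section \<open>Weighted square-summable functions\<close>

definition wl2 :: "('a \<Rightarrow> real) \<Rightarrow> ('a \<Rightarrow> complex) set" where
  "wl2 w = {u. (\<lambda>k. (w k * cmod (u k))\<^sup>2) summable_on UNIV}"

definition wl2_norm :: "('a \<Rightarrow> real) \<Rightarrow> ('a \<Rightarrow> complex) \<Rightarrow> real" where
  "wl2_norm w u = sqrt (\<Sum>\<^sub>\<infinity>k. (w k * cmod (u k))\<^sup>2)"

lemma L2_set_le_wl2_norm:
  assumes "u \<in> wl2 w" "finite F"
  shows "L2_set (\<lambda>k. w k * cmod (u k)) F \<le> wl2_norm w u"
  unfolding L2_set_def wl2_norm_def
  using assms by (intro real_sqrt_le_mono finite_sum_le_infsum) (auto simp: wl2_def)

text \<open>Membership and norm bounds both reduce to a uniform bound over finite index sets, so that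
  inequalities for \<open>L2_set\<close> carry over to infinite sums.\<close>

lemma wl2_of_finite_sums:
  assumes "\<And>F. finite F \<Longrightarrow> L2_set (\<lambda>k. w k * cmod (u k)) F \<le> C"
  shows "u \<in> wl2 w" and "wl2_norm w u \<le> C"
proof -
  have C: "0 \<le> C" using assms[of "{}"] by simp
  have le: "(\<Sum>k\<in>F. (w k * cmod (u k))\<^sup>2) \<le> C\<^sup>2" if "finite F" for F
    using assms[OF that] unfolding L2_set_def by (rule sqrt_le_D)
  show *: "u \<in> wl2 w"
    unfolding wl2_def
    by (auto intro!: nonneg_bdd_above_summable_on bdd_aboveI2[where M = "C\<^sup>2"] le)
  then have "(\<Sum>\<^sub>\<infinity>k. (w k * cmod (u k))\<^sup>2) \<le> C\<^sup>2"
    by (intro infsum_le_finite_sums le) (auto simp: wl2_def)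
  then show "wl2_norm w u \<le> C"
    unfolding wl2_norm_def using C by (intro real_le_lsqrt) (auto intro: infsum_nonneg)
qed

lemma wl2_pointwise: "u \<in> wl2 w \<Longrightarrow> w k * cmod (u k) \<le> wl2_norm w u"
  using L2_set_le_wl2_norm[of u w "{k}"] by simp

lemma wl2_scale:
  assumes "u \<in> wl2 w"
  shows "(\<lambda>k. c * u k) \<in> wl2 w" and "wl2_norm w (\<lambda>k. c * u k) = cmod c * wl2_norm w u"
proof -
  have eq: "(\<lambda>k. (w k * cmod (c * u k))\<^sup>2) = (\<lambda>k. (cmod c)\<^sup>2 * (w k * cmod (u k))\<^sup>2)"
    by (simp add: fun_eq_iff norm_mult power_mult_distrib)
  show "(\<lambda>k. c * u k) \<in> wl2 w"
    using assms unfolding wl2_def mem_Collect_eq eq by (rule summable_on_cmult_right)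
  show "wl2_norm w (\<lambda>k. c * u k) = cmod c * wl2_norm w u"
    unfolding wl2_norm_def eq by (simp add: infsum_cmult_right' real_sqrt_mult)
qed

lemma wl2_add:
  assumes w: "\<And>k. 0 \<le> w k" and u: "u \<in> wl2 w" and v: "v \<in> wl2 w"
  shows "(\<lambda>k. u k + v k) \<in> wl2 w"
    and "wl2_norm w (\<lambda>k. u k + v k) \<le> wl2_norm w u + wl2_norm w v"
proof -
  have *: "L2_set (\<lambda>k. w k * cmod (u k + v k)) F \<le> wl2_norm w u + wl2_norm w v" if "finite F" for F
  proof -
    have "L2_set (\<lambda>k. w k * cmod (u k + v k)) F
        \<le> L2_set (\<lambda>k. w k * cmod (u k) + w k * cmod (v k)) F"
      using w by (intro L2_set_mono)
        (auto simp: distrib_left[symmetric] intro!: mult_left_mono norm_triangle_ineq)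
    also have "\<dots> \<le> L2_set (\<lambda>k. w k * cmod (u k)) F + L2_set (\<lambda>k. w k * cmod (v k)) F"
      by (rule L2_set_triangle_ineq)
    also have "\<dots> \<le> wl2_norm w u + wl2_norm w v"
      by (intro add_mono L2_set_le_wl2_norm u v that)
    finally show ?thesis .
  qed
  show "(\<lambda>k. u k + v k) \<in> wl2 w" by (rule wl2_of_finite_sums(1)[OF *])
  show "wl2_norm w (\<lambda>k. u k + v k) \<le> wl2_norm w u + wl2_norm w v" by (rule wl2_of_finite_sums(2)[OF *])
qed

lemma wl2_finite_support: "finite {k. u k \<noteq> 0} \<Longrightarrow> u \<in> wl2 w"
  unfolding wl2_def mem_Collect_eq
  by (rule finite_nonzero_values_imp_summable_on) (auto elim: rev_finite_subset)

lemma function_norm_wl2: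
  assumes w: "\<And>k. 0 < w k"
  shows "function_norm (wl2 w) (wl2_norm w)"
proof
  show "(\<lambda>x. 0) \<in> wl2 w" by (simp add: wl2_finite_support)
  fix u v :: "'a \<Rightarrow> complex" and c assume u: "u \<in> wl2 w"
  show "(\<lambda>x. c * u x) \<in> wl2 w" "wl2_norm w (\<lambda>x. c * u x) = cmod c * wl2_norm w u"
    by (fact wl2_scale[OF u])+
  show "u = (\<lambda>x. 0)" if "wl2_norm w u \<le> 0"
  proof
    fix k
    have "w k * cmod (u k) \<le> 0" using wl2_pointwise[OF u, of k] that by simp
    then show "u k = 0" using w[of k] by (simp add: mult_le_0_iff)
  qed
  assume v: "v \<in> wl2 w"
  show "(\<lambda>x. u x + v x) \<in> wl2 w" "wl2_norm w (\<lambda>x. u x + v x) \<le> wl2_norm w u + wl2_norm w v"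
    by (fact wl2_add[OF less_imp_le[OF w] u v])+
qed

lemma wl2_mono:
  assumes le: "\<And>k. w k \<le> C * w' k" and w: "\<And>k. 0 \<le> w k" "\<And>k. 0 \<le> w' k"
    and C: "0 \<le> C" and u: "u \<in> wl2 w'"
  shows "u \<in> wl2 w" and "wl2_norm w u \<le> C * wl2_norm w' u"
proof -
  have *: "L2_set (\<lambda>k. w k * cmod (u k)) F \<le> C * wl2_norm w' u" if "finite F" for F
  proof -
    have "L2_set (\<lambda>k. w k * cmod (u k)) F \<le> L2_set (\<lambda>k. C * (w' k * cmod (u k))) F"
      using w le by (intro L2_set_mono) (auto simp: mult.assoc[symmetric] intro!: mult_right_mono)
    also have "\<dots> = C * L2_set (\<lambda>k. w' k * cmod (u k)) F"
      by (rule L2_set_right_distrib[OF C, symmetric])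
    also have "\<dots> \<le> C * wl2_norm w' u"
      by (intro mult_left_mono L2_set_le_wl2_norm u that C)
    finally show ?thesis .
  qed
  show "u \<in> wl2 w" by (rule wl2_of_finite_sums(1)[OF *])
  show "wl2_norm w u \<le> C * wl2_norm w' u" by (rule wl2_of_finite_sums(2)[OF *])
qed

text \<open>The squared norm of the part of \<open>u\<close> outside \<open>F\<close> is a tail of the convergent sum that
  defines \<open>\<parallel>u\<parallel>\<^sup>2\<close>.\<close>

lemma wl2_truncate:
  assumes u: "u \<in> wl2 w" and e: "0 < e"
  obtains F where "finite F" "wl2_norm w (\<lambda>k. u k - (if k \<in> F then u k else 0)) < e"
proof -
  let ?f = "\<lambda>k. (w k * cmod (u k))\<^sup>2"
  have sm: "?f summable_on UNIV" using u by (simp add: wl2_def)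
  obtain F where F: "finite F" "dist (sum ?f F) (infsum ?f UNIV) \<le> (e/2)\<^sup>2"
    using infsum_finite_approximation[OF sm, of "(e/2)\<^sup>2"] e by auto
  have "wl2_norm w (\<lambda>k. u k - (if k \<in> F then u k else 0)) \<le> e/2"
  proof (rule wl2_of_finite_sums(2))
    fix G :: "'a set" assume G: "finite G"
    have "(\<Sum>k\<in>G. (w k * cmod (u k - (if k \<in> F then u k else 0)))\<^sup>2) = sum ?f (G - F)"
      using G by (intro sum.mono_neutral_cong_right) auto
    also have "\<dots> = sum ?f (F \<union> G) - sum ?f F"
      using sum.subset_diff[of F "F \<union> G" ?f] F G by (simp add: Un_Diff)
    also have "\<dots> \<le> infsum ?f UNIV - sum ?f F"
      using F G by (intro diff_right_mono finite_sum_le_infsum[OF sm]) auto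
    also have "\<dots> \<le> (e/2)\<^sup>2" using F(2) by (simp add: dist_real_def)
    finally show "L2_set (\<lambda>k. w k * cmod (u k - (if k \<in> F then u k else 0))) G \<le> e/2"
      unfolding L2_set_def using e by (intro real_le_lsqrt) (auto intro: sum_nonneg)
  qed
  then show ?thesis using that F(1) e by simp
qed

section \<open>The duality pairing\<close>

text \<open>The form \<open>ell2_form\<close>, over an arbitrary index set.\<close>

definition pairing :: "('a \<Rightarrow> complex) \<Rightarrow> ('a \<Rightarrow> complex) \<Rightarrow> complex" where
  "pairing u v = (\<Sum>\<^sub>\<infinity>k. u k * cnj (v k))"

lemma pairing_commute: "pairing v u = cnj (pairing u v)"
  unfolding pairing_def infsum_cnj[symmetric] by (simp add: mult.commute)

lemma pairing_scale_left: "pairing (\<lambda>k. c * u k) v = c * pairing u v"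
  unfolding pairing_def mult.assoc by (rule infsum_cmult_right')

lemma pairing_scale_right: "pairing u (\<lambda>k. c * v k) = cnj c * pairing u v"
  by (subst (1 2) pairing_commute) (simp add: pairing_scale_left)

context
  fixes w :: "'a \<Rightarrow> real"
  assumes w: "\<And>k. 0 < w k"
begin

interpretation V: function_norm "wl2 w" "wl2_norm w"
  by (rule function_norm_wl2[OF w])

interpretation W: function_norm "wl2 (\<lambda>k. 1 / w k)" "wl2_norm (\<lambda>k. 1 / w k)"
  by (rule function_norm_wl2) (simp add: w)

text \<open>Since \<open>u k \<cdot> cnj (v k) = (w k \<cdot> u k) \<cdot> cnj (v k / w k)\<close>, this is the Cauchy-Schwarz
  inequality, applied to finite sums.\<close>

lemma pairing_bound:
  assumes u: "u \<in> wl2 w" and v: "v \<in> wl2 (\<lambda>k. 1 / w k)"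
  shows "(\<lambda>k. norm (u k * cnj (v k))) summable_on UNIV"
    and "cmod (pairing u v) \<le> wl2_norm w u * wl2_norm (\<lambda>k. 1 / w k) v"
proof -
  have *: "(\<Sum>k\<in>F. norm (u k * cnj (v k))) \<le> wl2_norm w u * wl2_norm (\<lambda>k. 1 / w k) v"
    if "finite F" for F
  proof -
    have "w k \<noteq> 0" for k using w[of k] by simp
    then have "(\<Sum>k\<in>F. norm (u k * cnj (v k)))
        = (\<Sum>k\<in>F. \<bar>w k * cmod (u k)\<bar> * \<bar>1 / w k * cmod (v k)\<bar>)"
      by (intro sum.cong) (simp_all add: norm_mult abs_mult)
    also have "\<dots> \<le> L2_set (\<lambda>k. w k * cmod (u k)) F * L2_set (\<lambda>k. 1 / w k * cmod (v k)) F"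
      by (rule L2_set_mult_ineq)
    also have "\<dots> \<le> wl2_norm w u * wl2_norm (\<lambda>k. 1 / w k) v"
      by (intro mult_mono L2_set_le_wl2_norm u v that V.norm_nonneg) simp
    finally show ?thesis .
  qed
  show sm: "(\<lambda>k. norm (u k * cnj (v k))) summable_on UNIV"
    by (rule nonneg_bdd_above_summable_on) (auto intro!: bdd_aboveI2 *)
  have "cmod (pairing u v) \<le> (\<Sum>\<^sub>\<infinity>k. norm (u k * cnj (v k)))"
    unfolding pairing_def by (rule norm_infsum_bound[OF sm])
  also have "\<dots> \<le> wl2_norm w u * wl2_norm (\<lambda>k. 1 / w k) v"
    by (rule infsum_le_finite_sums[OF sm *])
  finally show "cmod (pairing u v) \<le> wl2_norm w u * wl2_norm (\<lambda>k. 1 / w k) v" .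
qed

lemmas pairing_summable = abs_summable_summable[OF pairing_bound(1)]

lemma pairing_add_left:
  assumes "u \<in> wl2 w" "u' \<in> wl2 w" "v \<in> wl2 (\<lambda>k. 1 / w k)"
  shows "pairing (\<lambda>k. u k + u' k) v = pairing u v + pairing u' v"
  unfolding pairing_def distrib_right using assms by (intro infsum_add pairing_summable)

lemma pairing_add_right:
  assumes "u \<in> wl2 w" "v \<in> wl2 (\<lambda>k. 1 / w k)" "v' \<in> wl2 (\<lambda>k. 1 / w k)"
  shows "pairing u (\<lambda>k. v k + v' k) = pairing u v + pairing u v'"
  unfolding pairing_def distrib_left complex_cnj_add
  using assms by (intro infsum_add pairing_summable)

text \<open>For \<open>u \<noteq> 0\<close> the supremum is attained at the normalised multiple of \<open>w\<^sup>2 u\<close>: multiplication by \<open>w\<^sup>2\<close> is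
  an isometry of \<open>\<ell>\<^sup>2(w)\<close> onto \<open>\<ell>\<^sup>2(1/w)\<close>, and \<open>(u, w\<^sup>2 u) = \<parallel>u\<parallel>\<^sup>2\<close>.\<close>

lemma dual_norm_pairing:
  assumes u: "u \<in> wl2 w"
  defines "L \<equiv> \<lambda>v. if v \<in> wl2 (\<lambda>k. 1 / w k) then pairing u v else 0"
  shows "dual_norm (wl2 (\<lambda>k. 1 / w k)) (wl2_norm (\<lambda>k. 1 / w k)) L = wl2_norm w u"
proof -
  have le: "cmod (L v) \<le> wl2_norm w u"
    if "v \<in> wl2 (\<lambda>k. 1 / w k)" "wl2_norm (\<lambda>k. 1 / w k) v \<le> 1" for v
    using pairing_bound(2)[OF u that(1)]
      mult_left_mono[OF that(2) V.norm_nonneg[OF u]] that by (simp add: L_def)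
  have "\<exists>v. v \<in> wl2 (\<lambda>k. 1 / w k) \<and> wl2_norm (\<lambda>k. 1 / w k) v \<le> 1 \<and> cmod (L v) = wl2_norm w u"
  proof (cases "wl2_norm w u = 0")
    case True
    have "L (\<lambda>x. 0) = 0" by (simp add: L_def pairing_def)
    then show ?thesis using True W.zero_mem W.norm_zero by (intro exI[of _ "\<lambda>x. 0"]) simp
  next
    case False
    then have pos: "0 < wl2_norm w u" using V.norm_nonneg[OF u] by simp
    let ?z = "\<lambda>k. complex_of_real ((w k)\<^sup>2) * u k"
    have eq: "(\<lambda>k. (1 / w k * cmod (?z k))\<^sup>2) = (\<lambda>k. (w k * cmod (u k))\<^sup>2)"
      using w by (simp add: fun_eq_iff norm_mult power2_eq_square less_imp_neq[symmetric])
    have z: "?z \<in> wl2 (\<lambda>k. 1 / w k)" "wl2_norm (\<lambda>k. 1 / w k) ?z = wl2_norm w u"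
      using u unfolding wl2_def mem_Collect_eq wl2_norm_def eq by - (assumption, rule refl)
    let ?S = "\<Sum>\<^sub>\<infinity>k. (w k * cmod (u k))\<^sup>2"
    have "(\<lambda>k. u k * cnj (?z k)) = (\<lambda>k. complex_of_real ((w k * cmod (u k))\<^sup>2))"
      by (auto simp: fun_eq_iff power_mult_distrib complex_norm_square[symmetric])
    moreover have "((\<lambda>k. complex_of_real ((w k * cmod (u k))\<^sup>2)) has_sum complex_of_real ?S) UNIV"
      using u by (intro has_sum_of_real has_sum_infsum) (simp add: wl2_def)
    ultimately have p: "pairing u ?z = complex_of_real ?S"
      unfolding pairing_def by (simp add: infsumI)
    have S: "?S = (wl2_norm w u)\<^sup>2"
      by (simp add: wl2_norm_def infsum_nonneg)
    let ?c = "complex_of_real (1 / wl2_norm w u)"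
    have c: "cmod ?c = 1 / wl2_norm w u" unfolding norm_of_real using pos by simp
    have "cmod (L (\<lambda>k. ?c * ?z k)) = wl2_norm w u"
      using W.scale_mem[OF z(1), of ?c]
      by (simp only: L_def if_True pairing_scale_right p S norm_mult c complex_mod_cnj norm_of_real)
        (use pos in \<open>simp add: power2_eq_square\<close>)
    moreover have "wl2_norm (\<lambda>k. 1 / w k) (\<lambda>k. ?c * ?z k) = 1"
      unfolding W.norm_scale[OF z(1)] z(2) c using pos by simp
    ultimately show ?thesis using W.scale_mem[OF z(1), of ?c] by (intro exI[of _ "\<lambda>k. ?c * ?z k"]) simp
  qed
  then obtain v where "v \<in> wl2 (\<lambda>k. 1 / w k)" "wl2_norm (\<lambda>k. 1 / w k) v \<le> 1"
    "cmod (L v) = wl2_norm w u" by blast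
  then show ?thesis
    unfolding dual_norm_def
    by (intro cSup_eq_maximum) (auto intro: le image_eqI[of _ _ v])
qed

lemma pairing_antilinear:
  assumes "u \<in> wl2 w"
  shows "antilinear_functional (wl2 (\<lambda>k. 1 / w k)) (pairing u)"
  using assms by (simp add: semilinear_functional_def pairing_add_right pairing_scale_right)

lemma pairing_continuous_right:
  assumes "u \<in> wl2 w"
  shows "continuous_map (norm_topology (wl2 (\<lambda>k. 1 / w k)) (wl2_norm (\<lambda>k. 1 / w k))) euclidean (pairing u)"
  by (rule W.continuous_functional[OF pairing_antilinear[OF assms] pairing_bound(2)[OF assms]])

text \<open>The values of \<open>f\<close> on the unit vectors are the only candidate for \<open>u\<close>. Applying \<open>f\<close> to
  \<open>w\<^sup>2 u\<close> cut off to a finite set \<open>F\<close>, a function of norm \<open>s = \<parallel>u|\<^sub>F\<parallel>\<close>, gives \<open>s\<^sup>2 \<le> C s\<close>, that is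
  \<open>s \<le> C\<close>; hence \<open>u \<in> \<ell>\<^sup>2(w)\<close>. Both \<open>f\<close> and \<open>(u,\<cdot>)\<close> are bounded and agree on finitely supported
  functions, which are dense.\<close>

lemma pairing_represents:
  assumes f: "f \<in> dual_space cnj (wl2 (\<lambda>k. 1 / w k)) (wl2_norm (\<lambda>k. 1 / w k))"
  obtains u where "u \<in> wl2 w" "f = (\<lambda>v. if v \<in> wl2 (\<lambda>k. 1 / w k) then pairing u v else 0)"
proof -
  have fl: "antilinear_functional (wl2 (\<lambda>k. 1 / w k)) f"
    and fc: "continuous_map (norm_topology (wl2 (\<lambda>k. 1 / w k)) (wl2_norm (\<lambda>k. 1 / w k))) euclidean f"
    and f0: "\<And>v. v \<notin> wl2 (\<lambda>k. 1 / w k) \<Longrightarrow> f v = 0"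
    using f by (auto simp: dual_space_def)
  obtain C where C: "0 \<le> C" "\<And>v. v \<in> wl2 (\<lambda>k. 1 / w k) \<Longrightarrow> cmod (f v) \<le> C * wl2_norm (\<lambda>k. 1 / w k) v"
    using W.continuous_functional_bounded[OF fl complex_mod_cnj fc] by blast
  define u where "u k = f (\<lambda>j. if j = k then 1 else 0)" for k
  have fin_mem: "(\<lambda>k. if k \<in> F then v k else 0) \<in> wl2 w'" if "finite F" for F v and w' :: "'a \<Rightarrow> real"
    by (rule wl2_finite_support, rule finite_subset[OF _ that]) auto
  have f_fin: "f (\<lambda>k. if k \<in> F then v k else 0) = (\<Sum>k\<in>F. u k * cnj (v k))" if "finite F" for F v
    using that
  proof induction
    case empty
    show ?case
      using fl[unfolded semilinear_functional_def, THEN conjunct2, rule_format, OF W.zero_mem, of 0]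
      by simp
  next
    case (insert k F)
    have d: "(\<lambda>j. if j = k then 1 else 0) \<in> wl2 (\<lambda>k. 1 / w k)"
      using fin_mem[of "{k}" "\<lambda>_. 1"] by simp
    have "(\<lambda>j. if j \<in> insert k F then v j else 0)
        = (\<lambda>j. v k * (if j = k then 1 else 0) + (if j \<in> F then v j else 0))"
      using insert.hyps by (auto simp: fun_eq_iff)
    then have "f (\<lambda>j. if j \<in> insert k F then v j else 0)
        = cnj (v k) * u k + f (\<lambda>j. if j \<in> F then v j else 0)"
      using fl W.scale_mem[OF d, of "v k"] d fin_mem[OF insert.hyps(1), of v]
      by (simp add: semilinear_functional_def u_def)
    then show ?case using insert by simp
  qed
  have u: "u \<in> wl2 w"
  proof (rule wl2_of_finite_sums(1))
    fix F :: "'a set" assume F: "finite F"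
    let ?s = "L2_set (\<lambda>k. w k * cmod (u k)) F"
    let ?v = "\<lambda>k. if k \<in> F then complex_of_real ((w k)\<^sup>2) * u k else 0"
    have s2: "(\<Sum>k\<in>F. (w k * cmod (u k))\<^sup>2) = ?s\<^sup>2"
      by (simp add: L2_set_def sum_nonneg)
    have "f ?v = (\<Sum>k\<in>F. complex_of_real ((w k * cmod (u k))\<^sup>2))"
      unfolding f_fin[OF F]
      by (intro sum.cong) (auto simp: power_mult_distrib complex_norm_square[symmetric])
    then have "cmod (f ?v) = ?s\<^sup>2"
      unfolding of_real_sum[symmetric] s2 by (simp add: norm_power)
    moreover have "wl2_norm (\<lambda>k. 1 / w k) ?v \<le> ?s"
    proof (rule wl2_of_finite_sums(2))
      fix G :: "'a set" assume G: "finite G"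
      have "(\<Sum>k\<in>G. (1 / w k * cmod (?v k))\<^sup>2) = (\<Sum>k\<in>G \<inter> F. (w k * cmod (u k))\<^sup>2)"
        using G w by (intro sum.mono_neutral_cong_right)
          (auto simp: norm_mult power2_eq_square less_imp_neq[symmetric])
      also have "\<dots> \<le> (\<Sum>k\<in>F. (w k * cmod (u k))\<^sup>2)"
        using F by (intro sum_mono2) auto
      finally show "L2_set (\<lambda>k. 1 / w k * cmod (?v k)) G \<le> ?s"
        unfolding L2_set_def by (rule real_sqrt_le_mono)
    qed
    ultimately have "?s\<^sup>2 \<le> C * ?s"
      using C(2)[OF fin_mem[OF F], of "\<lambda>k. complex_of_real ((w k)\<^sup>2) * u k"]
        mult_left_mono[of "wl2_norm (\<lambda>k. 1 / w k) ?v" ?s C] C(1) by linarith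
    then show "?s \<le> C"
      using C(1) L2_set_nonneg[of "\<lambda>k. w k * cmod (u k)" F]
      by (cases "?s = 0") (auto simp: power2_eq_square mult_le_cancel_right)
  qed
  have "f v = pairing u v" if v: "v \<in> wl2 (\<lambda>k. 1 / w k)" for v
  proof (rule ccontr)
    assume ne: "f v \<noteq> pairing u v"
    \<comment> \<open>A bound for \<open>f - (u,\<cdot>)\<close>, made positive so that one can divide by it.\<close>
    let ?D = "C + wl2_norm w u + 1"
    have D: "0 < ?D" using C(1) V.norm_nonneg[OF u] by simp
    obtain F where F: "finite F"
      "wl2_norm (\<lambda>k. 1 / w k) (\<lambda>k. v k - (if k \<in> F then v k else 0)) < cmod (f v - pairing u v) / ?D"
      using wl2_truncate[OF v, of "cmod (f v - pairing u v) / ?D"] ne D by auto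
    let ?t = "\<lambda>k. if k \<in> F then v k else 0"
    let ?r = "\<lambda>k. v k - ?t k"
    have t: "?t \<in> wl2 (\<lambda>k. 1 / w k)" by (rule fin_mem[OF F(1)])
    have r: "?r \<in> wl2 (\<lambda>k. 1 / w k)" by (rule W.diff_mem[OF v t])
    have "pairing u ?t = (\<Sum>k\<in>F. u k * cnj (v k))"
      unfolding pairing_def
      by (subst infsum_cong_neutral[where T = F and g = "\<lambda>k. u k * cnj (v k)"])
        (auto simp: F(1))
    then have eq: "f ?t = pairing u ?t" using f_fin[OF F(1), of v] by simp
    have v_eq: "(\<lambda>k. ?r k + ?t k) = v" by auto
    have "f v = f ?r + f ?t"
      using fl[unfolded semilinear_functional_def, THEN conjunct1, rule_format, OF r t]
      unfolding v_eq .
    moreover have "pairing u v = pairing u ?r + pairing u ?t"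
      using pairing_add_right[OF u r t] unfolding v_eq .
    ultimately have "cmod (f v - pairing u v) = cmod (f ?r - pairing u ?r)" using eq by simp
    also have "\<dots> \<le> cmod (f ?r) + cmod (pairing u ?r)" by (rule norm_triangle_ineq4)
    also have "\<dots> \<le> ?D * wl2_norm (\<lambda>k. 1 / w k) ?r"
      using C(2)[OF r] pairing_bound(2)[OF u r] W.norm_nonneg[OF r] by (simp add: distrib_right)
    also have "\<dots> < cmod (f v - pairing u v)"
      using F(2) D by (simp add: field_simps)
    finally show False by simp
  qed
  then show ?thesis using that[OF u] f0 by (auto simp: fun_eq_iff)
qed

lemma pairing_onto_dual_space:
  "(\<lambda>u v. if v \<in> wl2 (\<lambda>k. 1 / w k) then pairing u v else 0) ` wl2 w
     = dual_space cnj (wl2 (\<lambda>k. 1 / w k)) (wl2_norm (\<lambda>k. 1 / w k))" (is "?L ` _ = ?D")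
proof
  show "?L ` wl2 w \<subseteq> ?D"
  proof
    fix f assume "f \<in> ?L ` wl2 w"
    then obtain u where u: "u \<in> wl2 w" and f: "f = ?L u" by blast
    have "antilinear_functional (wl2 (\<lambda>k. 1 / w k)) f"
      using pairing_antilinear[OF u] W.add_mem W.scale_mem by (simp add: semilinear_functional_def f)
    moreover have "cmod (f v) \<le> wl2_norm w u * wl2_norm (\<lambda>k. 1 / w k) v"
      if "v \<in> wl2 (\<lambda>k. 1 / w k)" for v
      using pairing_bound(2)[OF u that] that by (simp add: f)
    ultimately show "f \<in> ?D"
      using W.continuous_functional[of cnj f "wl2_norm w u"] by (simp add: dual_space_def f)
  qed
  show "?D \<subseteq> ?L ` wl2 w"
    by (blast elim: pairing_represents)
qed

lemma homeomorphic_map_pairing: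
  "homeomorphic_map (norm_topology (wl2 w) (wl2_norm w))
     (dual_topology cnj (wl2 (\<lambda>k. 1 / w k)) (wl2_norm (\<lambda>k. 1 / w k)))
     (\<lambda>u v. if v \<in> wl2 (\<lambda>k. 1 / w k) then pairing u v else 0)" (is "homeomorphic_map _ _ ?L")
  unfolding dual_topology_def
proof (rule V.homeomorphic_map_isometry[OF pairing_onto_dual_space])
  fix u u' assume u: "u \<in> wl2 w" "u' \<in> wl2 w"
  have "pairing (\<lambda>k. u k - u' k) v = pairing u v - pairing u' v"
    if "v \<in> wl2 (\<lambda>k. 1 / w k)" for v
    using pairing_add_left[OF V.diff_mem[OF u] u(2) that] by simp
  then have "(\<lambda>v. ?L u v - ?L u' v) = ?L (\<lambda>k. u k - u' k)"
    by (simp add: fun_eq_iff)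
  then show "dual_norm (wl2 (\<lambda>k. 1 / w k)) (wl2_norm (\<lambda>k. 1 / w k)) (\<lambda>v. ?L u v - ?L u' v)
      = wl2_norm w (\<lambda>k. u k - u' k)"
    using dual_norm_pairing[OF V.diff_mem[OF u]] by simp
qed

end

text \<open>Conjugation turns the representation of anti-linear functionals into that of linear ones.\<close>

lemma dual_space_cnj_iff:
  "(\<lambda>u. cnj (f u)) \<in> dual_space cnj V N \<longleftrightarrow> f \<in> dual_space (\<lambda>c. c) V N"
proof -
  have "cnj (f a) = cnj c * cnj b \<longleftrightarrow> f a = c * b" for a b c
    by (metis complex_cnj_cnj complex_cnj_mult)
  moreover have "cnj (f a) = cnj b + cnj c \<longleftrightarrow> f a = b + c" for a b c
    by (metis complex_cnj_cnj complex_cnj_add)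
  moreover have "continuous_map X euclidean (\<lambda>u. cnj (f u)) \<longleftrightarrow> continuous_map X euclidean f" for X
  proof -
    have cnj: "continuous_map euclidean euclidean cnj"
      by (simp add: continuous_on_cnj)
    show ?thesis
      using continuous_map_compose[OF _ cnj, of X f] continuous_map_compose[OF _ cnj, of X "\<lambda>u. cnj (f u)"]
      by (auto simp: o_def)
  qed
  ultimately show ?thesis
    by (simp add: dual_space_def semilinear_functional_def)
qed

text \<open>The map \<open>v \<mapsto> (\<cdot>,v)\<close> is the pointwise conjugate of \<open>v \<mapsto> (v,\<cdot>)\<close>, to which the results on
  the first variable apply with the weight \<open>1/w\<close> in place of \<open>w\<close>.\<close>

theorem mutually_dual_wl2:
  assumes w: "\<And>k. 0 < w k"
  shows "mutually_dual (wl2 w) (wl2_norm w) (wl2 (\<lambda>k. 1 / w k)) (wl2_norm (\<lambda>k. 1 / w k)) pairing"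
proof -
  let ?w' = "\<lambda>k. 1 / w k"
  have w': "0 < ?w' k" for k using w by simp
  interpret V: function_norm "wl2 w" "wl2_norm w" by (rule function_norm_wl2[OF w])
  interpret W: function_norm "wl2 ?w'" "wl2_norm ?w'" by (rule function_norm_wl2[OF w'])
  let ?L = "\<lambda>u v. if v \<in> wl2 ?w' then pairing u v else 0"
  let ?R = "\<lambda>v u. if u \<in> wl2 w then pairing u v else 0"
  have R: "?R v = (\<lambda>u. cnj (if u \<in> wl2 w then pairing v u else 0))" for v
    by (auto simp: fun_eq_iff pairing_commute[symmetric])
  have "semilinear_operator (\<lambda>c. c) (wl2 w) ?L"
    by (auto simp: semilinear_operator_def fun_eq_iff pairing_add_left[of w, OF w] pairing_scale_left)
  moreover have "semilinear_operator cnj (wl2 ?w') ?R"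
    by (auto simp: semilinear_operator_def fun_eq_iff pairing_add_right[of w, OF w] pairing_scale_right)
  moreover have "homeomorphic_map (norm_topology (wl2 w) (wl2_norm w))
      (dual_topology cnj (wl2 ?w') (wl2_norm ?w')) ?L"
    by (rule homeomorphic_map_pairing[of w, OF w])
  moreover have "homeomorphic_map (norm_topology (wl2 ?w') (wl2_norm ?w'))
      (dual_topology (\<lambda>c. c) (wl2 w) (wl2_norm w)) ?R"
    unfolding dual_topology_def
  proof (rule W.homeomorphic_map_isometry)
    have im: "(\<lambda>v u. if u \<in> wl2 w then pairing v u else 0) ` wl2 ?w' = dual_space cnj (wl2 w) (wl2_norm w)"
      using pairing_onto_dual_space[OF w'] by simp
    show "?R ` wl2 ?w' = dual_space (\<lambda>c. c) (wl2 w) (wl2_norm w)"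
    proof (intro set_eqI iffI)
      fix f assume "f \<in> ?R ` wl2 ?w'"
      then obtain v where v: "v \<in> wl2 ?w'" "f = ?R v" by blast
      then have "(\<lambda>u. cnj (f u)) = (\<lambda>u. if u \<in> wl2 w then pairing v u else 0)"
        by (simp add: R)
      then show "f \<in> dual_space (\<lambda>c. c) (wl2 w) (wl2_norm w)"
        using im v(1) unfolding dual_space_cnj_iff[symmetric] by (metis (no_types, lifting) imageI)
    next
      fix f assume "f \<in> dual_space (\<lambda>c. c) (wl2 w) (wl2_norm w)"
      then have "(\<lambda>u. cnj (f u)) \<in> (\<lambda>v u. if u \<in> wl2 w then pairing v u else 0) ` wl2 ?w'"
        unfolding im dual_space_cnj_iff .
      then obtain v where v: "v \<in> wl2 ?w'" "(\<lambda>u. cnj (f u)) = (\<lambda>u. if u \<in> wl2 w then pairing v u else 0)"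
        by blast
      have "f = ?R v"
        unfolding R
      proof
        show "f u = cnj (if u \<in> wl2 w then pairing v u else 0)" for u
          by (subst fun_cong[OF v(2), symmetric]) simp
      qed
      then show "f \<in> ?R ` wl2 ?w'" using v(1) by blast
    qed
    fix v v' assume v: "v \<in> wl2 ?w'" "v' \<in> wl2 ?w'"
    have d: "(\<lambda>k. v k - v' k) \<in> wl2 ?w'" by (rule W.diff_mem[OF v])
    have "pairing u (\<lambda>k. v k - v' k) = pairing u v - pairing u v'" if "u \<in> wl2 w" for u
      using pairing_add_right[of w, OF w that d v(2)] by simp
    then have "(\<lambda>u. ?R v u - ?R v' u) = ?R (\<lambda>k. v k - v' k)"
      by (simp add: fun_eq_iff)
    moreover have "dual_norm (wl2 w) (wl2_norm w) (?R (\<lambda>k. v k - v' k)) = wl2_norm ?w' (\<lambda>k. v k - v' k)"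
      using dual_norm_pairing[OF w' d] unfolding R by (simp add: dual_norm_def)
    ultimately show "dual_norm (wl2 w) (wl2_norm w) (\<lambda>u. ?R v u - ?R v' u) = wl2_norm ?w' (\<lambda>k. v k - v' k)"
      by simp
  qed
  ultimately show ?thesis
    by (simp add: mutually_dual_def Let_def)
qed

lemma separately_continuous_pairing:
  assumes w: "\<And>k. 0 < w k"
  shows "separately_continuous_sesquilinear (wl2 w) (wl2_norm w)
     (wl2 (\<lambda>k. 1 / w k)) (wl2_norm (\<lambda>k. 1 / w k)) pairing"
proof -
  interpret V: function_norm "wl2 w" "wl2_norm w" by (rule function_norm_wl2[OF w])
  have lin: "linear_functional (wl2 w) (\<lambda>u. pairing u v)" if "v \<in> wl2 (\<lambda>k. 1 / w k)" for v
    using that by (simp add: semilinear_functional_def pairing_add_left[of w, OF w] pairing_scale_left)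
  have "continuous_map (norm_topology (wl2 w) (wl2_norm w)) euclidean (\<lambda>u. pairing u v)"
    if "v \<in> wl2 (\<lambda>k. 1 / w k)" for v
    using pairing_bound(2)[of w, OF w _ that]
    by (intro V.continuous_functional[OF lin[OF that], of "wl2_norm (\<lambda>k. 1 / w k) v"])
      (simp add: mult.commute)
  then show ?thesis
    unfolding separately_continuous_sesquilinear_def
    using lin pairing_antilinear[of w, OF w] pairing_continuous_right[of w, OF w] by blast
qed

section \<open>Functions of RO type\<close>

lemma RO_pos: "\<phi> \<in> RO \<Longrightarrow> 1 \<le> t \<Longrightarrow> 0 < \<phi> t"
  by (simp add: RO_def)

lemma RO_inverse: "\<phi> \<in> RO \<Longrightarrow> (\<lambda>t. 1 / \<phi> t) \<in> RO"
proof -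
  assume \<phi>: "\<phi> \<in> RO"
  obtain a c where a: "a > 1" and c: "c \<ge> 1"
    and b: "\<And>t r. 1 \<le> t \<Longrightarrow> r \<in> {1..a} \<Longrightarrow> inverse c \<le> \<phi> (r * t) / \<phi> t \<and> \<phi> (r * t) / \<phi> t \<le> c"
    using \<phi> unfolding RO_def by blast
  have "inverse c \<le> 1 / \<phi> (r * t) / (1 / \<phi> t) \<and> 1 / \<phi> (r * t) / (1 / \<phi> t) \<le> c"
    if t: "1 \<le> t" and r: "r \<in> {1..a}" for t r
  proof -
    have "1 * 1 \<le> r * t" using t r by (intro mult_mono) auto
    then have "0 < \<phi> t" "0 < \<phi> (r * t)" using RO_pos[OF \<phi>] t by auto
    then show ?thesis using b[OF t r] c by (simp add: field_simps)
  qed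
  then have "\<exists>a>1. \<exists>c\<ge>1. \<forall>t\<ge>1. \<forall>r\<in>{1..a}.
      inverse c \<le> 1 / \<phi> (r * t) / (1 / \<phi> t) \<and> 1 / \<phi> (r * t) / (1 / \<phi> t) \<le> c"
    using a c by blast
  moreover have "(\<lambda>t. 1 / \<phi> t) \<in> borel_measurable (restrict_space borel {1..})"
    using \<phi> unfolding RO_def by (auto intro!: borel_measurable_divide)
  ultimately show ?thesis
    using RO_pos[OF \<phi>] unfolding RO_def by simp
qed

text \<open>A step by the factor \<open>a\<close> costs at most the factor \<open>c\<close>, and \<open>N\<close> with \<open>c \<le> a\<^sup>N\<close> turns this into
  a power of \<open>t\<close>. A lower bound for \<open>\<phi>\<close> follows by applying the lemma to \<open>1/\<phi>\<close>.\<close>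

lemma RO_growth:
  assumes \<phi>: "\<phi> \<in> RO"
  obtains C N where "0 < C" "\<And>t. 1 \<le> t \<Longrightarrow> \<phi> t \<le> C * t ^ N"
proof -
  obtain a c where a: "a > 1" and c: "c \<ge> 1"
    and b: "\<And>t r. 1 \<le> t \<Longrightarrow> r \<in> {1..a} \<Longrightarrow> \<phi> (r * t) / \<phi> t \<le> c"
    using \<phi> unfolding RO_def by blast
  have step: "\<phi> (r * t) \<le> c * \<phi> t" if "1 \<le> t" "r \<in> {1..a}" for t r
    using b[OF that] RO_pos[OF \<phi> that(1)] by (simp add: field_simps)
  obtain N where N: "c < a ^ N" using real_arch_pow[OF a] by blast
  have pos: "0 < c * \<phi> 1" using c RO_pos[OF \<phi>, of 1] by simp
  have *: "\<phi> t \<le> c * \<phi> 1 * t ^ N" if "1 \<le> t" "t \<le> a ^ m" for t m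
    using that
  proof (induction m arbitrary: t)
    case 0
    then show ?case using mult_right_mono[OF c, of "\<phi> 1"] RO_pos[OF \<phi>, of 1] by auto
  next
    case (Suc m)
    show ?case
    proof (cases "t \<le> a")
      case True
      then have "\<phi> t \<le> c * \<phi> 1" using step[of 1 t] Suc.prems by simp
      also have "\<dots> \<le> c * \<phi> 1 * t ^ N"
        using pos one_le_power[OF Suc.prems(1), of N] mult_left_mono[of 1 "t ^ N" "c * \<phi> 1"] by simp
      finally show ?thesis .
    next
      case False
      have s: "1 \<le> t / a" "t / a \<le> a ^ m"
        using False Suc.prems a by (simp_all add: field_simps)
      have "\<phi> t \<le> c * \<phi> (t / a)" using step[OF s(1), of a] a by simp
      also have "\<dots> \<le> a ^ N * \<phi> (t / a)"
        using N RO_pos[OF \<phi> s(1)] by (intro mult_right_mono) auto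
      also have "\<dots> \<le> a ^ N * (c * \<phi> 1 * (t / a) ^ N)"
        using a by (intro mult_left_mono Suc.IH s) auto
      also have "\<dots> = c * \<phi> 1 * t ^ N" using a by (simp add: power_divide)
      finally show ?thesis .
    qed
  qed
  show ?thesis
  proof
    fix t :: real assume "1 \<le> t"
    obtain m where "t < a ^ m" using real_arch_pow[OF a] by blast
    then show "\<phi> t \<le> c * \<phi> 1 * t ^ N" using *[OF \<open>1 \<le> t\<close>, of m] by simp
  qed (fact pos)
qed

section \<open>The spaces on the lattice as weighted square-summable functions\<close>

lemma bracket_ge_1: "1 \<le> bracket k"
  by (simp add: bracket_def)

lemma bracket_squared: "(bracket k)\<^sup>2 = 1 + (\<Sum>i\<in>UNIV. (real_of_int (k $ i))\<^sup>2)"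
  by (simp add: bracket_def lattice_norm_def sum_nonneg add_nonneg_nonneg)

text \<open>The equality holds for all functions: if the sum diverges, then both infinite sums have the
  default value \<open>0\<close>.\<close>

lemma H_norm_eq: "H_norm \<phi> = wl2_norm (\<lambda>k. \<phi> (bracket k))"
proof
  fix u :: "int ^ 'n \<Rightarrow> complex"
  let ?f = "\<lambda>k. (\<phi> (bracket k) * cmod (u k))\<^sup>2"
  have eq: "(\<lambda>k. of_real ((\<phi> (bracket k))\<^sup>2) * u k * cnj (u k)) = (\<lambda>k. complex_of_real (?f k))"
    by (simp add: fun_eq_iff power_mult_distrib complex_norm_square[symmetric])
  have "Re (\<Sum>\<^sub>\<infinity>k. complex_of_real (?f k)) = infsum ?f UNIV"
  proof (cases "?f summable_on UNIV")
    case True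
    then show ?thesis by (subst infsum_Re[symmetric]) (simp_all only: summable_on_of_real Re_complex_of_real)
  next
    case False
    then have "\<not> (\<lambda>k. complex_of_real (?f k)) summable_on UNIV"
      using summable_on_Re[of "\<lambda>k. complex_of_real (?f k)" UNIV] by (simp only: Re_complex_of_real) blast
    from infsum_not_exists[OF this] infsum_not_exists[OF False] show ?thesis
      by (simp only: zero_complex.sel)
  qed
  then show "H_norm \<phi> u = wl2_norm (\<lambda>k. \<phi> (bracket k)) u"
    by (simp only: H_norm_def H_inner_def wl2_norm_def eq)
qed

text \<open>Every single term bounds \<open>\<bar>u k\<bar> \<le> \<parallel>u\<parallel> / \<phi> \<langle>k\<rangle>\<close>, and \<open>1/\<phi>\<close> grows at most polynomially; so
  the condition of temperedness follows from summability.\<close>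

lemma H_space_eq:
  assumes "\<phi> \<in> RO"
  shows "H_space \<phi> = wl2 (\<lambda>k. \<phi> (bracket k))"
proof -
  have pos: "0 < \<phi> (bracket k)" for k :: "int ^ 'n"
    using RO_pos[OF assms bracket_ge_1] .
  obtain C N where C: "0 < C" "\<And>t. 1 \<le> t \<Longrightarrow> 1 / \<phi> t \<le> C * t ^ N"
    using RO_growth[OF RO_inverse[OF assms]] by blast
  have "u \<in> tempered" if u: "u \<in> wl2 (\<lambda>k. \<phi> (bracket k))" for u :: "int ^ 'n \<Rightarrow> complex"
  proof -
    let ?n = "wl2_norm (\<lambda>k. \<phi> (bracket k)) u"
    have "cmod (u k) \<le> (?n * C) * bracket k ^ N" for k
    proof -
      have n: "\<phi> (bracket k) * cmod (u k) \<le> ?n" by (rule wl2_pointwise[OF u])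
      moreover have "0 \<le> \<phi> (bracket k) * cmod (u k)" using pos[of k] by simp
      ultimately have "0 \<le> ?n" by linarith
      have "cmod (u k) = (\<phi> (bracket k) * cmod (u k)) * (1 / \<phi> (bracket k))"
        using pos[of k] by simp
      also have "\<dots> \<le> ?n * (C * bracket k ^ N)"
        using n \<open>0 \<le> ?n\<close> pos[of k] by (intro mult_mono C(2) bracket_ge_1) auto
      finally show ?thesis by (simp add: mult.assoc)
    qed
    then show ?thesis unfolding tempered_def by blast
  qed
  moreover have "(\<lambda>k. of_real (\<phi> (bracket k)) * u k) \<in> ell2 \<longleftrightarrow> u \<in> wl2 (\<lambda>k. \<phi> (bracket k))"
    for u :: "int ^ 'n \<Rightarrow> complex"
    using pos by (simp add: ell2_def wl2_def norm_mult abs_of_pos[OF pos])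
  ultimately show ?thesis by (auto simp: H_space_def)
qed

section \<open>Schwartz functions\<close>

lemma fwd_diff_multi_invariant:
  fixes u :: "int ^ 'n::finite \<Rightarrow> complex"
  assumes step: "\<And>j v. P v \<Longrightarrow> P ((fwd_diff j ^^ (\<beta> $ j)) v)" and u: "P u"
  shows "P (fwd_diff_multi \<beta> u)"
proof -
  interpret comp_fun_commute "\<lambda>j. fwd_diff j ^^ (\<beta> $ j)"
    by (rule comp_fun_commute_fwd_diff)
  have "P (Finite_Set.fold (\<lambda>j. fwd_diff j ^^ (\<beta> $ j)) u J)" for J
    using finite[of J] by induction (auto simp: u step)
  then show ?thesis by (simp add: fwd_diff_multi_def)
qed

lemma schwartz_finite_support:
  fixes u :: "int ^ 'n::finite \<Rightarrow> complex"
  assumes "finite {k. u k \<noteq> 0}"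
  shows "u \<in> schwartz"
proof -
  have step: "finite {k. fwd_diff j v k \<noteq> 0}" if "finite {k. v k \<noteq> 0}" for j :: 'n and v
  proof (rule finite_subset)
    show "{k. fwd_diff j v k \<noteq> 0} \<subseteq> (\<lambda>k. k - axis j 1) ` {k. v k \<noteq> 0} \<union> {k. v k \<noteq> 0}"
    proof
      fix k assume "k \<in> {k. fwd_diff j v k \<noteq> 0}"
      then have "v (k + axis j 1) \<noteq> 0 \<or> v k \<noteq> 0" by (auto simp: fwd_diff_def)
      then show "k \<in> (\<lambda>k. k - axis j 1) ` {k. v k \<noteq> 0} \<union> {k. v k \<noteq> 0}"
        by (auto intro: image_eqI[of _ _ "k + axis j 1"])
    qed
  qed (use that in simp)
  have pow: "finite {k. (fwd_diff j ^^ m) v k \<noteq> 0}" if "finite {k. v k \<noteq> 0}" for j :: 'n and v m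
    by (induction m) (simp_all add: that step)
  have fin: "finite {k. fwd_diff_multi \<beta> u k \<noteq> 0}" for \<beta>
    by (rule fwd_diff_multi_invariant[where P = "\<lambda>v. finite {k. v k \<noteq> 0}", OF pow assms])
  have "finite (range (\<lambda>k. cmod (of_int (multi_power k \<alpha>) * fwd_diff_multi \<beta> u k)))" for \<alpha> \<beta>
  proof (rule finite_subset)
    let ?g = "\<lambda>k. cmod (of_int (multi_power k \<alpha>) * fwd_diff_multi \<beta> u k)"
    show "range ?g \<subseteq> insert 0 (?g ` {k. fwd_diff_multi \<beta> u k \<noteq> 0})" by auto
  qed (use fin in simp)
  then show ?thesis
    unfolding schwartz_def by (auto intro: bdd_above_finite)
qed

lemma fwd_diff_multi_0:
  fixes u :: "int ^ 'n::finite \<Rightarrow> complex"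
  shows "fwd_diff_multi 0 u = u"
  by (rule fwd_diff_multi_invariant[where P = "\<lambda>v. v = u"]) simp_all

text \<open>The bound comes from the seminorms with \<open>\<beta> = 0\<close> and the monomials \<open>1\<close> and \<open>k\<^sub>i\<^sup>2\<^sup>M\<close>: if \<open>m\<close> is the largest of the numbers
  \<open>1\<close> and \<open>k\<^sub>i\<^sup>2\<close>, then \<open>\<langle>k\<rangle>\<^sup>2 \<le> (n + 1) m\<close> and \<open>m\<^sup>M \<le> 1 + \<Sum>\<^sub>i k\<^sub>i\<^sup>2\<^sup>M\<close>.\<close>

lemma schwartz_decay:
  fixes u :: "int ^ 'n::finite \<Rightarrow> complex"
  assumes u: "u \<in> schwartz"
  obtains C where "0 \<le> C" "\<And>k. bracket k ^ M * cmod (u k) \<le> C"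
proof -
  have bdd: "\<exists>B. \<forall>k. cmod (of_int (multi_power k \<alpha>) * u k) \<le> B" for \<alpha>
    using u unfolding schwartz_def bdd_above_def
    by simp (metis fwd_diff_multi_0)
  have mp: "multi_power k (axis i m) = (k $ i) ^ m" for k :: "int ^ 'n" and i m
  proof -
    have "multi_power k (axis i m) = (\<Prod>j\<in>UNIV. if j = i then (k $ i) ^ m else 1)"
      unfolding multi_power_def by (intro prod.cong) (auto simp: axis_def)
    then show ?thesis by simp
  qed
  obtain B0 where B0: "\<And>k. cmod (u k) \<le> B0"
    using bdd[of 0] by (auto simp: multi_power_def)
  have "\<forall>i. \<exists>B. \<forall>k. cmod (of_int ((k $ i) ^ (2 * M)) * u k) \<le> B"
    using bdd mp by metis
  then obtain B where B: "\<And>i k. cmod (of_int ((k $ i) ^ (2 * M)) * u k) \<le> B i" by metis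
  define n where "n = real CARD('n)"
  define C where "C = (n + 1) ^ M * (B0 + (\<Sum>i\<in>UNIV. B i))"
  have "bracket k ^ M * cmod (u k) \<le> C" for k
  proof -
    let ?s = "\<lambda>i. (real_of_int (k $ i))\<^sup>2"
    define m where "m = Max (insert 1 (range ?s))"
    have m: "1 \<le> m" "?s i \<le> m" for i
      unfolding m_def by (rule Max_ge; simp)+
    have "m \<in> insert 1 (range ?s)" unfolding m_def by (rule Max_in) auto
    then have mM: "m ^ M \<le> 1 + (\<Sum>i\<in>UNIV. ?s i ^ M)"
    proof
      assume "m = 1" then show ?thesis by (simp add: sum_nonneg)
    next
      assume "m \<in> range ?s"
      then obtain i where "m = ?s i" by blast
      then show ?thesis using member_le_sum[of i UNIV "\<lambda>i. ?s i ^ M"] by simp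
    qed
    have "bracket k ^ M \<le> (bracket k ^ M)\<^sup>2"
      using one_le_power[OF bracket_ge_1, of k M] by (simp add: power2_eq_square)
    also have "\<dots> = ((bracket k)\<^sup>2) ^ M" by (simp add: power_mult[symmetric] mult.commute)
    also have "\<dots> \<le> ((n + 1) * m) ^ M"
    proof (rule power_mono)
      have "(\<Sum>i\<in>UNIV. ?s i) \<le> n * m"
        using sum_bounded_above[of UNIV ?s m] m(2) by (simp add: n_def)
      then show "(bracket k)\<^sup>2 \<le> (n + 1) * m"
        using m(1) by (simp add: bracket_squared distrib_right)
    qed simp
    also have "\<dots> \<le> (n + 1) ^ M * (1 + (\<Sum>i\<in>UNIV. ?s i ^ M))"
      unfolding power_mult_distrib using mM by (intro mult_left_mono) (auto simp: n_def)
    finally have "bracket k ^ M * cmod (u k) \<le> (n + 1) ^ M * (1 + (\<Sum>i\<in>UNIV. ?s i ^ M)) * cmod (u k)"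
      by (rule mult_right_mono) simp
    also have "\<dots> = (n + 1) ^ M * (cmod (u k) + (\<Sum>i\<in>UNIV. ?s i ^ M * cmod (u k)))"
      by (simp add: distrib_right sum_distrib_right mult.assoc)
    also have "\<dots> \<le> C"
      unfolding C_def
    proof (intro mult_left_mono add_mono sum_mono B0)
      fix i
      show "?s i ^ M * cmod (u k) \<le> B i"
        using B[of k i] by (simp add: norm_mult norm_power power_mult[symmetric] power_even_abs)
    qed (simp add: n_def)
    finally show ?thesis .
  qed
  moreover from this[of 0] have "0 \<le> C"
    by (rule order.trans[rotated]) (use bracket_ge_1[of "0 :: int ^ 'n"] in simp)
  ultimately show ?thesis using that by blast
qed

lemma summable_on_int_inverse_squares: "(\<lambda>j::int. 1 / (1 + (real_of_int j)\<^sup>2)) summable_on UNIV"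
proof -
  let ?f = "\<lambda>j::int. 1 / (1 + (real_of_int j)\<^sup>2)"
  have "summable (\<lambda>n::nat. norm (1 / (1 + (real n)\<^sup>2)))"
    by (rule summable_comparison_test_ev[OF _ inverse_power_summable[of 2, where 'a = real]])
      (auto simp: eventually_sequentially inverse_eq_divide intro!: exI[of _ 1] frac_le)
  then have nat: "(\<lambda>n::nat. 1 / (1 + (real n)\<^sup>2)) summable_on UNIV"
    by (rule norm_summable_imp_summable_on)
  have "?f summable_on range int" "?f summable_on range (\<lambda>n. - int n)"
    using nat by (subst summable_on_reindex; simp add: inj_on_def o_def)+
  then have "?f summable_on (range int \<union> range (\<lambda>n. - int n))"
    by (rule summable_on_union)
  moreover have "range int \<union> range (\<lambda>n. - int n) = UNIV"
    by (auto simp: image_iff) (metis int_cases2)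
  ultimately show ?thesis by simp
qed

lemma summable_on_lattice_product:
  "(\<lambda>k :: int ^ 'n::finite. \<Prod>i\<in>UNIV. 1 / (1 + (real_of_int (k $ i))\<^sup>2)) summable_on UNIV"
proof -
  let ?f = "\<lambda>j::int. 1 / (1 + (real_of_int j)\<^sup>2)"
  have "Infinite_Set_Sum.abs_summable_on ?f UNIV"
    using summable_on_int_inverse_squares unfolding abs_summable_equivalent[symmetric] by simp
  then have "Infinite_Set_Sum.abs_summable_on (\<lambda>g. \<Prod>i\<in>(UNIV :: 'n set). ?f (g i)) (PiE UNIV (\<lambda>_. UNIV))"
    by (intro abs_summable_on_prod_PiE) auto
  moreover have "PiE (UNIV :: 'n set) (\<lambda>_. UNIV :: int set) = UNIV" by (auto simp: PiE_def)
  ultimately have "(\<lambda>g. \<Prod>i\<in>(UNIV :: 'n set). ?f (g i)) summable_on UNIV"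
    unfolding abs_summable_equivalent[symmetric] by (metis abs_summable_summable)
  moreover have "bij_betw (\<lambda>k::int ^ 'n. vec_nth k) UNIV UNIV"
    by (rule bij_betw_byWitness[where f' = vec_lambda]) auto
  ultimately show ?thesis
    using summable_on_reindex_bij_betw[of vec_nth UNIV UNIV "\<lambda>g. \<Prod>i\<in>(UNIV :: 'n set). ?f (g i)"] by simp
qed

text \<open>If \<open>\<phi> t \<le> C t\<^sup>N\<close>, then decay of order \<open>N + n\<close> leaves \<open>\<phi> \<langle>k\<rangle> \<bar>u k\<bar> = O(\<langle>k\<rangle>\<^sup>-\<^sup>n)\<close>. The square is
  summable because \<open>\<langle>k\<rangle>\<^sup>2\<^sup>n \<ge> \<Prod>\<^sub>i (1 + k\<^sub>i\<^sup>2)\<close>.\<close>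

lemma schwartz_subset_H_space:
  assumes \<phi>: "\<phi> \<in> RO"
  shows "(schwartz :: (int ^ 'n::finite \<Rightarrow> complex) set) \<subseteq> H_space \<phi>"
proof
  fix u :: "int ^ 'n \<Rightarrow> complex" assume u: "u \<in> schwartz"
  obtain C N where C: "0 < C" "\<And>t. 1 \<le> t \<Longrightarrow> \<phi> t \<le> C * t ^ N"
    using RO_growth[OF \<phi>] by blast
  define n where "n = CARD('n)"
  obtain D where D: "0 \<le> D" "\<And>k. bracket k ^ (N + n) * cmod (u k) \<le> D"
    using schwartz_decay[OF u] by blast
  have le: "(\<phi> (bracket k) * cmod (u k))\<^sup>2 \<le> (C * D)\<^sup>2 * (\<Prod>i\<in>UNIV. 1 / (1 + (real_of_int (k $ i))\<^sup>2))" for k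
  proof -
    have b: "0 < bracket k" using bracket_ge_1[of k] by linarith
    have P: "0 < (\<Prod>i\<in>UNIV. 1 + (real_of_int (k $ i))\<^sup>2)"
      by (intro prod_pos) (auto intro: add_pos_nonneg)
    have "\<phi> (bracket k) * cmod (u k) * bracket k ^ n \<le> C * bracket k ^ N * cmod (u k) * bracket k ^ n"
      using b by (intro mult_right_mono C bracket_ge_1) auto
    also have "\<dots> \<le> C * D"
      using mult_left_mono[OF D(2)[of k], of C] C(1) by (simp add: power_add mult_ac)
    finally have "(\<phi> (bracket k) * cmod (u k) * bracket k ^ n)\<^sup>2 \<le> (C * D)\<^sup>2"
      using b RO_pos[OF \<phi> bracket_ge_1, of k] by (intro power_mono) auto
    moreover have "(\<Prod>i\<in>UNIV. 1 + (real_of_int (k $ i))\<^sup>2) \<le> (bracket k ^ n)\<^sup>2"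
    proof -
      have "(\<Prod>i\<in>UNIV. 1 + (real_of_int (k $ i))\<^sup>2) \<le> (\<Prod>i\<in>(UNIV :: 'n set). (bracket k)\<^sup>2)"
        unfolding bracket_squared
        by (intro prod_mono) (auto intro: member_le_sum[of _ UNIV "\<lambda>i. (real_of_int (k $ i))\<^sup>2"])
      then show ?thesis by (simp add: n_def power_mult[symmetric] mult.commute)
    qed
    ultimately have "(\<phi> (bracket k) * cmod (u k))\<^sup>2 * (\<Prod>i\<in>UNIV. 1 + (real_of_int (k $ i))\<^sup>2) \<le> (C * D)\<^sup>2"
      unfolding power_mult_distrib[of _ "bracket k ^ n"] by (meson mult_left_mono order.trans zero_le_power2)
    then show ?thesis using P by (simp add: prod_dividef field_simps)
  qed
  have sm: "(\<lambda>k::int ^ 'n. (C * D)\<^sup>2 * (\<Prod>i\<in>UNIV. 1 / (1 + (real_of_int (k $ i))\<^sup>2))) summable_on UNIV"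
    by (intro summable_on_cmult_right summable_on_lattice_product)
  have "u \<in> wl2 (\<lambda>k. \<phi> (bracket k))"
    unfolding wl2_def mem_Collect_eq by (rule summable_on_comparison_test[OF sm le]) simp
  then show "u \<in> H_space \<phi>" by (simp add: H_space_eq[OF \<phi>])
qed

lemma schwartz_dense:
  assumes \<phi>: "\<phi> \<in> RO"
  shows "norm_topology (H_space \<phi>) (H_norm \<phi>) closure_of (schwartz :: (int ^ 'n::finite \<Rightarrow> complex) set) = H_space \<phi>"
proof -
  let ?w = "\<lambda>k :: int ^ 'n. \<phi> (bracket k)"
  interpret function_norm "wl2 ?w" "wl2_norm ?w"
    by (rule function_norm_wl2) (rule RO_pos[OF \<phi> bracket_ge_1])
  interpret M: Metric_space "wl2 ?w" "norm_dist (wl2 ?w) (wl2_norm ?w)"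
    by (rule Metric_space_norm_dist)
  have "\<exists>v\<in>schwartz. v \<in> M.mball u r" if u: "u \<in> wl2 ?w" and r: "0 < r" for u r
  proof -
    obtain F where F: "finite F" "wl2_norm ?w (\<lambda>k. u k - (if k \<in> F then u k else 0)) < r"
      using wl2_truncate[OF u r] .
    have fin: "finite {k. (if k \<in> F then u k else 0) \<noteq> 0}"
      by (rule finite_subset[OF _ F(1)]) auto
    show ?thesis
      using schwartz_finite_support[OF fin] wl2_finite_support[OF fin] u F(2)
      by (intro bexI[of _ "\<lambda>k. if k \<in> F then u k else 0"]) (simp_all add: norm_dist_def)
  qed
  then show ?thesis
    unfolding H_space_eq[OF \<phi>] H_norm_eq norm_topology_def M.metric_closure_of by blast
qed

section \<open>Embeddings\<close>

lemma continuously_embedded_I: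
  assumes V: "function_norm V N" and W: "function_norm W M" and "V \<subseteq> W"
    and "\<And>u. u \<in> V \<Longrightarrow> M u \<le> C * N u"
  shows "continuously_embedded V N W M"
  unfolding continuously_embedded_def
  using assms function_norm.diff_mem[OF V]
  by (auto intro!: function_norm.continuous_into_normed[OF V W])

lemma H_space_embedding:
  assumes 0: "\<phi>0 \<in> RO" and 1: "\<phi>1 \<in> RO" and bdd: "Bfun (\<lambda>t. \<phi>0 t / \<phi>1 t) at_top"
  shows "continuously_embedded (H_space \<phi>1) (H_norm \<phi>1) (H_space \<phi>0) (H_norm \<phi>0)"
proof -
  obtain K T where K: "0 < K" "\<And>t. T \<le> t \<Longrightarrow> \<bar>\<phi>0 t / \<phi>1 t\<bar> \<le> K"
    using bdd unfolding Bfun_def eventually_at_top_linorder by auto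
  obtain C N where C: "0 < C" "\<And>t. 1 \<le> t \<Longrightarrow> \<phi>0 t \<le> C * t ^ N"
    using RO_growth[OF 0] by blast
  obtain C' N' where C': "0 < C'" "\<And>t. 1 \<le> t \<Longrightarrow> 1 / \<phi>1 t \<le> C' * t ^ N'"
    using RO_growth[OF RO_inverse[OF 1]] by blast
  \<comment> \<open>\<open>K\<close> serves for \<open>t \<ge> T\<close>, the product of the two polynomial bounds at \<open>\<bar>T\<bar>\<close> for \<open>1 \<le> t < T\<close>.\<close>
  define D where "D = max K (C * \<bar>T\<bar> ^ N * (C' * \<bar>T\<bar> ^ N'))"
  have le: "\<phi>0 t \<le> D * \<phi>1 t" if t: "1 \<le> t" for t
  proof -
    have pos: "0 < \<phi>0 t" "0 < \<phi>1 t" using RO_pos 0 1 t by auto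
    have "\<phi>0 t / \<phi>1 t \<le> D"
    proof (cases "T \<le> t")
      case True
      then show ?thesis unfolding D_def using K(2)[OF True] by linarith
    next
      case False
      have "\<phi>0 t \<le> C * \<bar>T\<bar> ^ N"
        using False t C(1) by (intro order.trans[OF C(2)[OF t]] mult_left_mono power_mono) auto
      moreover have "1 / \<phi>1 t \<le> C' * \<bar>T\<bar> ^ N'"
        using False t C'(1) by (intro order.trans[OF C'(2)[OF t]] mult_left_mono power_mono) auto
      ultimately have "\<phi>0 t * (1 / \<phi>1 t) \<le> C * \<bar>T\<bar> ^ N * (C' * \<bar>T\<bar> ^ N')"
        using pos C(1) by (intro mult_mono) auto
      then show ?thesis by (simp add: D_def)
    qed
    then show ?thesis using pos by (simp add: field_simps)
  qed
  have "0 \<le> D" using K(1) by (simp add: D_def)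
  note pos0 = RO_pos[OF 0 bracket_ge_1] and pos1 = RO_pos[OF 1 bracket_ge_1]
  note mono = wl2_mono[OF le[OF bracket_ge_1] less_imp_le[OF pos0] less_imp_le[OF pos1] \<open>0 \<le> D\<close>]
  show ?thesis
    unfolding H_space_eq[OF 0] H_space_eq[OF 1] H_norm_eq
    by (rule continuously_embedded_I[OF function_norm_wl2[OF pos1] function_norm_wl2[OF pos0]])
      (use mono in auto)
qed

lemma function_norm_ell_inf: "function_norm ell_inf ell_inf_norm"
proof
  have le: "cmod (u k) \<le> ell_inf_norm u" if "u \<in> ell_inf" for u and k :: "int ^ 'n"
  proof -
    have "bdd_above (range (\<lambda>k. cmod (u k)))"
      using that unfolding ell_inf_def bounded_iff bdd_above_def by auto
    then show ?thesis unfolding ell_inf_norm_def by (rule cSUP_upper[rotated]) simp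
  qed
  show "(\<lambda>x. 0) \<in> ell_inf" by (simp add: ell_inf_def)
  fix u v :: "int ^ 'n \<Rightarrow> complex" and c assume u: "u \<in> ell_inf"
  show s: "(\<lambda>x. c * u x) \<in> ell_inf" for c
  proof -
    obtain B where "\<And>k. cmod (u k) \<le> B" using u by (auto simp: ell_inf_def bounded_iff)
    then have "cmod (c * u k) \<le> cmod c * B" for k by (simp add: norm_mult mult_left_mono)
    then show ?thesis by (auto simp: ell_inf_def bounded_iff)
  qed
  show "ell_inf_norm (\<lambda>x. c * u x) = cmod c * ell_inf_norm u"
  proof (rule antisym)
    show "ell_inf_norm (\<lambda>x. c * u x) \<le> cmod c * ell_inf_norm u"
      unfolding ell_inf_norm_def[of "\<lambda>x. c * u x"] norm_mult
      by (intro cSUP_least mult_left_mono le u) auto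
    show "cmod c * ell_inf_norm u \<le> ell_inf_norm (\<lambda>x. c * u x)"
    proof (cases "c = 0")
      case True
      then show ?thesis by (simp add: ell_inf_norm_def)
    next
      case False
      have "ell_inf_norm u \<le> ell_inf_norm (\<lambda>x. c * u x) / cmod c"
        unfolding ell_inf_norm_def[of u]
      proof (intro cSUP_least)
        fix k
        show "cmod (u k) \<le> ell_inf_norm (\<lambda>x. c * u x) / cmod c"
          using le[OF s, of c k] False by (simp add: norm_mult field_simps)
      qed simp
      then show ?thesis using False by (simp add: field_simps)
    qed
  qed
  show "u = (\<lambda>x. 0)" if "ell_inf_norm u \<le> 0"
  proof
    fix k
    show "u k = 0" using order.trans[OF le[OF u, of k] that] by simp
  qed
  assume v: "v \<in> ell_inf"
  show "(\<lambda>x. u x + v x) \<in> ell_inf"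
    using u v unfolding ell_inf_def by (simp add: bounded_plus_comp)
  show "ell_inf_norm (\<lambda>x. u x + v x) \<le> ell_inf_norm u + ell_inf_norm v"
    unfolding ell_inf_norm_def[of "\<lambda>x. u x + v x"]
    by (intro cSUP_least order.trans[OF norm_triangle_ineq] add_mono le u v) simp
qed

lemma H_space_embedding_ell_inf:
  assumes \<phi>: "\<phi> \<in> RO" and sm: "(\<lambda>k :: int ^ 'n::finite. 1 / (\<phi> (bracket k))\<^sup>2) summable_on UNIV"
  shows "continuously_embedded (H_space \<phi> :: (int ^ 'n \<Rightarrow> complex) set) (H_norm \<phi>) ell_inf ell_inf_norm"
proof -
  let ?w = "\<lambda>k :: int ^ 'n. \<phi> (bracket k)"
  have pos: "0 < ?w k" for k by (rule RO_pos[OF \<phi> bracket_ge_1])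
  define S where "S = (\<Sum>\<^sub>\<infinity>k. 1 / (?w k)\<^sup>2)"
  have bound: "cmod (u k) \<le> sqrt S * wl2_norm ?w u" if u: "u \<in> wl2 ?w" for u k
  proof -
    have "1 / (?w k)\<^sup>2 \<le> S"
      unfolding S_def using finite_sum_le_infsum[OF sm, of "{k}"] by simp
    then have "1 / ?w k \<le> sqrt S"
      using pos[of k] by (intro real_le_rsqrt) (simp add: power_divide)
    then have "1 / ?w k * (?w k * cmod (u k)) \<le> sqrt S * wl2_norm ?w u"
      using pos[of k] wl2_pointwise[OF u, of k] by (intro mult_mono) (auto simp: S_def infsum_nonneg)
    then show ?thesis using pos[of k] by simp
  qed
  show ?thesis
    unfolding H_space_eq[OF \<phi>] H_norm_eq
  proof (rule continuously_embedded_I[OF function_norm_wl2[OF pos] function_norm_ell_inf])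
    show "wl2 ?w \<subseteq> ell_inf"
      using bound unfolding ell_inf_def bounded_iff by blast
    show "ell_inf_norm u \<le> sqrt S * wl2_norm ?w u" if "u \<in> wl2 ?w" for u
      unfolding ell_inf_norm_def by (intro cSUP_least bound that) simp
  qed
qed

theorem theorem2p4:
  shows
    "(\<forall>\<phi>\<in>RO. (schwartz :: (int ^ 'n::finite \<Rightarrow> complex) set) \<subseteq> H_space \<phi> \<and>
        norm_topology (H_space \<phi>) (H_norm \<phi>) closure_of (schwartz :: (int ^ 'n \<Rightarrow> complex) set) = H_space \<phi>) \<and>
     (\<forall>\<phi>0\<in>RO. \<forall>\<phi>1\<in>RO. Bfun (\<lambda>t. \<phi>0 t / \<phi>1 t) at_top \<longrightarrow>
        continuously_embedded (H_space \<phi>1 :: (int ^ 'n \<Rightarrow> complex) set) (H_norm \<phi>1) (H_space \<phi>0) (H_norm \<phi>0)) \<and>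
     (\<forall>\<phi>\<in>RO. \<exists>B :: (int ^ 'n \<Rightarrow> complex) \<Rightarrow> (int ^ 'n \<Rightarrow> complex) \<Rightarrow> complex.
        (\<forall>u\<in>schwartz. \<forall>v\<in>schwartz. B u v = ell2_form u v) \<and>
        separately_continuous_sesquilinear
          (H_space \<phi>) (H_norm \<phi>) (H_space (\<lambda>t. 1 / \<phi> t)) (H_norm (\<lambda>t. 1 / \<phi> t)) B \<and>
        mutually_dual
          (H_space \<phi>) (H_norm \<phi>) (H_space (\<lambda>t. 1 / \<phi> t)) (H_norm (\<lambda>t. 1 / \<phi> t)) B) \<and>
     (\<forall>\<phi>\<in>RO. (\<lambda>k :: int ^ 'n. 1 / (\<phi> (bracket k))\<^sup>2) summable_on UNIV \<longrightarrow>
        continuously_embedded (H_space \<phi> :: (int ^ 'n \<Rightarrow> complex) set) (H_norm \<phi>) ell_inf ell_inf_norm)"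
proof (intro conjI ballI impI)
  fix \<phi> assume \<phi>: "\<phi> \<in> RO"
  show "(schwartz :: (int ^ 'n \<Rightarrow> complex) set) \<subseteq> H_space \<phi>"
    by (rule schwartz_subset_H_space[OF \<phi>])
  show "norm_topology (H_space \<phi>) (H_norm \<phi>) closure_of (schwartz :: (int ^ 'n \<Rightarrow> complex) set) = H_space \<phi>"
    by (rule schwartz_dense[OF \<phi>])
  show "\<exists>B :: (int ^ 'n \<Rightarrow> complex) \<Rightarrow> (int ^ 'n \<Rightarrow> complex) \<Rightarrow> complex.
        (\<forall>u\<in>schwartz. \<forall>v\<in>schwartz. B u v = ell2_form u v) \<and>
        separately_continuous_sesquilinear
          (H_space \<phi>) (H_norm \<phi>) (H_space (\<lambda>t. 1 / \<phi> t)) (H_norm (\<lambda>t. 1 / \<phi> t)) B \<and>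
        mutually_dual
          (H_space \<phi>) (H_norm \<phi>) (H_space (\<lambda>t. 1 / \<phi> t)) (H_norm (\<lambda>t. 1 / \<phi> t)) B"
  proof -
    let ?w = "\<lambda>k :: int ^ 'n. \<phi> (bracket k)"
    have pos: "0 < ?w k" for k by (rule RO_pos[OF \<phi> bracket_ge_1])
    show ?thesis
      unfolding H_space_eq[OF \<phi>] H_space_eq[OF RO_inverse[OF \<phi>]] H_norm_eq
      using separately_continuous_pairing[of ?w, OF pos] mutually_dual_wl2[of ?w, OF pos]
      by (intro exI[of _ pairing]) (simp add: pairing_def ell2_form_def)
  qed
next
  fix \<phi>0 \<phi>1 :: "real \<Rightarrow> real"
  assume "\<phi>0 \<in> RO" "\<phi>1 \<in> RO" "Bfun (\<lambda>t. \<phi>0 t / \<phi>1 t) at_top"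
  then show "continuously_embedded (H_space \<phi>1 :: (int ^ 'n \<Rightarrow> complex) set) (H_norm \<phi>1) (H_space \<phi>0) (H_norm \<phi>0)"
    by (rule H_space_embedding)
next
  fix \<phi> assume "\<phi> \<in> RO" "(\<lambda>k :: int ^ 'n. 1 / (\<phi> (bracket k))\<^sup>2) summable_on UNIV"
  then show "continuously_embedded (H_space \<phi> :: (int ^ 'n \<Rightarrow> complex) set) (H_norm \<phi>) ell_inf ell_inf_norm"
    by (rule H_space_embedding_ell_inf)
qed

end
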